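(* Consider the setting of the context, with a time horizon $\tau>0$ and a matrix $\Pi=\Pi^{\mathrm T}\succ0$ in $\mathbb{R}^{r\times r}$. For $0\leqslant t\leqslant\tau$ and $v\in\mathbb{R}^{n\times(n+1)}$, let the Bellman function be $$\Psi(t,v):=\inf_{U\in C([t,\tau],\mathbb{R}^r)}\Big(\Delta(\tau)+\frac12\int_t^\tau\|U(s)\|_\Pi^2\,\mathrm{d}s\Big),$$ where $\Delta(\tau)=\langle R,z(\tau)\rangle+d$ and $z$ is the solution on $[t,\tau]$ of $\dot z(s)=(A_*+\mathcal{A}\cdot U(s))z(s)+c$ initialised at $z(t)=v$. Suppose $\Psi$ is continuously differentiable (including continuous differentiability with respect to its second argument in the sense of Frechet). Then its Hamilton-Jacobi-Bellman equation takes the form of the PDE $$\partial_t\Psi+\langle\partial_v\Psi,A_*v+c\rangle-\frac12\big\|(\partial_v\Psi\, v^{\mathrm T})\star\mathcal{A}\big\|_{\Pi^{-1}}^2=0$$ (that is, $\Psi$ satisfies this PDE) for all $0\leqslant t\leqslant\tau$, $v\in\mathbb{R}^{n\times(n+1)}$, with the terminal condition $$\Psi(\tau,v)=\langle R,v\rangle+d,\qquad v\in\mathbb{R}^{n\times(n+1)}.$$ The optimal control law, as a time-dependent function of the current state $v$ of the system for $z$, is described by $$\widehat u(t,v)=-\Pi^{-1}\big((\partial_v\Psi(t,v)\,v^{\mathrm T})\star\mathcal{A}\big).$$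
   Context: Conventions. For an array $T=(T_{jk\ell})\in\mathbb{C}^{p\times q\times s}$ with sections $T_\ell:=(T_{jk\ell})_{j,k}\in\mathbb{C}^{p\times q}$ and a vector $w$ of $s$ entries (numbers or operators), $T\cdot w:=\sum_{\ell=1}^s T_\ell w_\ell$; also $T_{\ell\bullet\bullet}:=(T_{\ell jk})_{j,k}$. For $T\in\mathbb{R}^{n\times n\times n}$ and $u\in\mathbb{R}^n$, $T\diamond u:=\begin{bmatrix}T_1u&\ldots&T_nu\end{bmatrix}$. For a real matrix $u\in\mathbb{R}^{p\times q}$ and a real array $T\in\mathbb{R}^{p\times q\times s}$, $u\star T:=(\langle u,T_k\rangle)_{1\leqslant k\leqslant s}\in\mathbb{R}^s$, where $\langle\cdot,\cdot\rangle$ is the Frobenius inner product of real matrices. $\mathrm{vec}$ is column-stacking vectorization, $\|u\|_S^2:=u^{\mathrm T}Su$ for a positive definite symmetric matrix $S$. The Frechet derivative $\partial_v\Psi$ is identified with an $\mathbb{R}^{n\times(n+1)}$-valued function via the Frobenius inner product. Setting. An open quantum memory system on $\mathfrak{H}_0\otimes\mathfrak{F}$ ($\mathfrak{H}_0$ a finite-dimensional complex Hilbert space, $\mathfrak{F}$ a symmetric Fock space in the vacuum state, product state $\rho=\rho_0\otimes\upsilon$ with $\rho_0$ a density operator on $\mathfrak{H}_0$ and $\upsilon$ the vacuum state, $\mathbf{E}\zeta:=\mathrm{Tr}(\rho\zeta)$) has a vector $X(t)$ of $n$ self-adjoint variables with $X(t)X(t)^{\mathrm T}=\alpha+\beta\cdot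 X(t)$, where $\alpha=\alpha^{\mathrm T}\in\mathbb{R}^{n\times n}$ and $\beta\in\mathbb{C}^{n\times n\times n}$ has Hermitian sections $\beta_\ell$; $X_0:=X(0)$ consists of Hermitian operators on $\mathfrak{H}_0$. Put $\Theta:=\mathrm{Im}\,\beta=(\theta_{jk\ell})$ with sections $\Theta_\ell$, and $\gamma:=\mathrm{Re}\,\beta$ with sections $\gamma_\ell$. With $m$ even, let $J:=I_{m/2}\otimes\begin{bmatrix}0&1\\-1&0\end{bmatrix}$, and let $E_*\in\mathbb{R}^n$, $K\in\mathbb{R}^{n\times r}$ (columns $K_1,\ldots,K_r$), $M\in\mathbb{R}^{m\times n}$, $N\in\mathbb{R}^m$ be the energy and coupling parameters (Hamiltonian $(E_*+KU)^{\mathrm T}X$ with deterministic control $U$, coupling operators $MX+N$ to an $m$-channel quantum Wiener process $W$ with Ito matrix $I_m+iJ$). The system obeys $\mathrm{d}X=(AX+b)\mathrm{d}t+2(\Theta\cdot X)M^{\mathrm T}\mathrm{d}W$ with $$b:=2\begin{bmatrix}\Theta_1&\ldots&\Theta_n\end{bmatrix}\mathrm{vec}(M^{\mathrm T}JM\alpha),\qquad A(t):=A_*+\mathcal{A}\cdot U(t),$$ $$A_*:=2\Theta\diamond(E_*+M^{\mathrm T}JN)+2\sum_{\ell=1}^n\Theta_\ell M^{\mathrm T}(M\theta_{\ell\bullet\bullet}+JM\,\mathrm{Re}\,\beta_{\ell\bullet\bullet}),$$ and $\mathcal{A}\in\mathbb{R}^{n\times n\times r}$ the array with sections $A_k:=2\Theta\diamond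 K_k\in\mathbb{R}^{n\times n}$, $k=1,\ldots,r$. Let $\mu_0:=\mathbf{E}X_0\in\mathbb{R}^n$, $P:=\mathrm{Re}\,\mathbf{E}(X_0X_0^{\mathrm T})=\alpha+\gamma\cdot\mu_0$, $\Sigma:=F^{\mathrm T}F$ with a given full row rank matrix $F\in\mathbb{R}^{\nu\times n}$ ($\nu\leqslant n$), $\sigma:=\Sigma\star\gamma\in\mathbb{R}^n$, $R:=\begin{bmatrix}\sigma&-2\Sigma\end{bmatrix}\in\mathbb{R}^{n\times(n+1)}$, $d:=2\langle\Sigma,P\rangle-\sigma^{\mathrm T}\mu_0$, and $c:=b\begin{bmatrix}1&\mu_0^{\mathrm T}\end{bmatrix}\in\mathbb{R}^{n\times(n+1)}$. The mean-square deviation $\Delta(t)=\mathbf{E}\big((X(t)-X_0)^{\mathrm T}\Sigma(X(t)-X_0)\big)$ equals $\langle R,z(t)\rangle+d$, where $z$ is the state of the auxiliary system $\dot z=(A_*+\mathcal{A}\cdot U)z+c$ with $z(0)=\begin{bmatrix}\mu_0&P\end{bmatrix}$; the control problem is to minimise $\Delta(\tau)+\frac12\int_0^\tau\|U(t)\|_\Pi^2\mathrm{d}t$ over $U\in C([0,\tau],\mathbb{R}^r)$. The Hamilton-Jacobi-Bellman equation of this problem is $-\partial_t\Psi=\min_{u\in\mathbb{R}^r}\big(\langle\partial_v\Psi,(A_*+\mathcal{A}\cdot u)v+c\rangle+\frac12\|u\|_\Pi^2\big)$, and the optimal control law is the function $\widehat u(t,v)$ assigning to $(t,v)$ the (unique)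 minimising $u$ on its right-hand side. *)

theory Defs
  imports "HOL-Analysis.Analysis"
begin

text \<open>
  Conventions. An array with entries T (j, k, l) of size p x q x s has type
  \<open>'a^'s^'q^'p\<close>, so that its entries are \<open>T $ j $ k $ l\<close>; \<open>T $ j\<close> is the slice obtained by
  fixing the first index. A matrix with n rows and n + 1 columns has type
  \<open>real^('n option)^'n\<close>, the first column being the one with index \<open>None\<close>. The Frobenius inner
  product is the library's inner product on \<open>real^'q^'p\<close>. The even number m is twice the
  cardinality of \<open>'k\<close>, and m-dimensional vectors are indexed by \<open>'k \<times> 2\<close>.
\<close>

definition sect :: "'a^'s^'q^'p \<Rightarrow> 's \<Rightarrow> 'a^'q^'p" where
  "sect T l = (\<chi> j k. T $ j $ k $ l)"

definition array_dot :: "real^'s^'q^'p \<Rightarrow> real^'s \<Rightarrow> real^'q^'p" where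
  "array_dot T w = (\<Sum>l\<in>UNIV. w $ l *\<^sub>R sect T l)"

definition diamond :: "real^'n^'n^'n \<Rightarrow> real^'n \<Rightarrow> real^'n^'n" where
  "diamond T u = (\<chi> j l. (sect T l *v u) $ j)"

definition star_prod :: "real^'q^'p \<Rightarrow> real^'s^'q^'p \<Rightarrow> real^'s" where
  "star_prod u T = (\<chi> k. u \<bullet> sect T k)"

definition sq_norm_wrt :: "real^'n^'n \<Rightarrow> real^'n \<Rightarrow> real" where
  "sq_norm_wrt S u = u \<bullet> (S *v u)"

definition pos_def :: "real^'n^'n \<Rightarrow> bool" where
  "pos_def S \<longleftrightarrow> transpose S = S \<and> (\<forall>x. x \<noteq> 0 \<longrightarrow> 0 < x \<bullet> (S *v x))"

definition Re_array :: "complex^'s^'q^'p \<Rightarrow> real^'s^'q^'p" where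
  "Re_array T = (\<chi> j k l. Re (T $ j $ k $ l))"

definition Im_array :: "complex^'s^'q^'p \<Rightarrow> real^'s^'q^'p" where
  "Im_array T = (\<chi> j k l. Im (T $ j $ k $ l))"

text \<open>
  Vectorization stacks columns, so an entry of \<open>vec_cols B\<close> is indexed by (column, row);
  \<open>sect_row T\<close> is the block row of the sections of T.
\<close>

definition vec_cols :: "real^'q^'p \<Rightarrow> real^('q \<times> 'p)" where
  "vec_cols B = (\<chi> i. B $ snd i $ fst i)"

definition sect_row :: "real^'s^'q^'p \<Rightarrow> real^('s \<times> 'q)^'p" where
  "sect_row T = (\<chi> j i. sect T (fst i) $ j $ snd i)"

definition hcat :: "real^'n \<Rightarrow> real^'n^'n \<Rightarrow> real^('n option)^'n" where
  "hcat x B = (\<chi> j i. case i of None \<Rightarrow> x $ j | Some k \<Rightarrow> B $ j $ k)"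

definition outer_one :: "real^'n \<Rightarrow> real^'n \<Rightarrow> real^('n option)^'n" where
  "outer_one x y = (\<chi> j i. x $ j * (case i of None \<Rightarrow> 1 | Some k \<Rightarrow> y $ k))"

definition kron :: "real^'b^'a \<Rightarrow> real^'d^'c \<Rightarrow> real^('b \<times> 'd)^('a \<times> 'c)" where
  "kron A B = (\<chi> i j. A $ fst i $ fst j * B $ snd i $ snd j)"

definition Jmat :: "real^('k \<times> 2)^('k::finite \<times> 2)" where
  "Jmat = kron (mat 1) (vector [vector [0, 1], vector [-1, 0]])"

text \<open>Operators on the finite-dimensional Hilbert space are complex square matrices.\<close>

definition hermitian :: "complex^'d^'d \<Rightarrow> bool" where
  "hermitian B \<longleftrightarrow> (\<forall>i j. B $ i $ j = cnj (B $ j $ i))"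

definition density_operator :: "complex^'d^'d \<Rightarrow> bool" where
  "density_operator \<rho> \<longleftrightarrow> hermitian \<rho>
     \<and> (\<forall>x. 0 \<le> Re (\<Sum>i\<in>UNIV. cnj (x $ i) * (\<rho> *v x) $ i)) \<and> trace \<rho> = 1"

definition expect :: "complex^'d^'d \<Rightarrow> complex^'d^'d \<Rightarrow> complex" where
  "expect \<rho> B = trace (\<rho> ** B)"

text \<open>
  The relation \<open>X X\<^sup>T = \<alpha> + \<beta> \<cdot> X\<close>; here \<open>mat a\<close> is the multiple of the
  identity operator by the scalar \<open>a\<close>.
\<close>

definition algebraic_vars :: "real^'n^'n \<Rightarrow> complex^'n^'n^'n \<Rightarrow> complex^'d^'d^'n \<Rightarrow> bool" where
  "algebraic_vars \<alpha> \<beta> X \<longleftrightarrow> transpose \<alpha> = \<alpha> \<and> (\<forall>l. hermitian (sect \<beta> l))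
     \<and> (\<forall>j. hermitian (X $ j))
     \<and> (\<forall>j k. X $ j ** X $ k = mat (of_real (\<alpha> $ j $ k)) + (\<Sum>l\<in>UNIV. mat (\<beta> $ j $ k $ l) ** X $ l))"

text \<open>For Hermitian operators the expectations in \<open>mean_vec\<close> are real, so \<open>Re\<close> only changes the type.\<close>

definition mean_vec :: "complex^'d^'d \<Rightarrow> complex^'d^'d^'n \<Rightarrow> real^'n" where
  "mean_vec \<rho> X = (\<chi> j. Re (expect \<rho> (X $ j)))"

definition second_moments :: "complex^'d^'d \<Rightarrow> complex^'d^'d^'n \<Rightarrow> real^'n^'n" where
  "second_moments \<rho> X = (\<chi> j k. Re (expect \<rho> (X $ j ** X $ k)))"

definition drift_b :: "complex^'n^'n^'n \<Rightarrow> real^'n^'n \<Rightarrow> real^'n^('k::finite \<times> 2) \<Rightarrow> real^'n" where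
  "drift_b \<beta> \<alpha> M =
     2 *\<^sub>R (sect_row (Im_array \<beta>) *v vec_cols (transpose M ** Jmat ** M ** \<alpha>))"

definition drift_A ::
  "complex^'n^'n^'n \<Rightarrow> real^'n \<Rightarrow> real^'n^('k::finite \<times> 2) \<Rightarrow> real^('k \<times> 2) \<Rightarrow> real^'n^'n" where
  "drift_A \<beta> E M N =
     2 *\<^sub>R diamond (Im_array \<beta>) (E + transpose M *v (Jmat *v N))
     + 2 *\<^sub>R (\<Sum>l\<in>UNIV. sect (Im_array \<beta>) l ** transpose M **
          (M ** Im_array \<beta> $ l + Jmat ** M ** Re_array \<beta> $ l))"

definition control_array :: "complex^'n^'n^'n \<Rightarrow> real^'r^'n \<Rightarrow> real^'r^'n^'n" where
  "control_array \<beta> K = (\<chi> i j k. (2 *\<^sub>R diamond (Im_array \<beta>) (column k K)) $ i $ j)"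

definition state_rhs ::
  "real^'n^'n \<Rightarrow> real^'r^'n^'n \<Rightarrow> real^('n option)^'n \<Rightarrow> real^'r \<Rightarrow> real^('n option)^'n
     \<Rightarrow> real^('n option)^'n" where
  "state_rhs A0 AA c u v = (A0 + array_dot AA u) ** v + c"

definition solves_state ::
  "real^'n^'n \<Rightarrow> real^'r^'n^'n \<Rightarrow> real^('n option)^'n \<Rightarrow> real \<Rightarrow> real \<Rightarrow> real^('n option)^'n
     \<Rightarrow> (real \<Rightarrow> real^'r) \<Rightarrow> (real \<Rightarrow> real^('n option)^'n) \<Rightarrow> bool" where
  "solves_state A0 AA c \<tau> t v U z \<longleftrightarrow> z t = v \<and>
     (\<forall>s\<in>{t..\<tau>}. (z has_vector_derivative state_rhs A0 AA c (U s) (z s)) (at s within {t..\<tau>}))"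

text \<open>
  The infimum is taken in the extended reals, since the cost need not be bounded below for an
  arbitrary starting point. The state \<open>z\<close> is determined on \<open>{t..\<tau>}\<close> by the control \<open>U\<close> (the
  equation being linear), so this is an infimum over continuous controls.
\<close>

definition bellman ::
  "real^'n^'n \<Rightarrow> real^'r^'n^'n \<Rightarrow> real^('n option)^'n \<Rightarrow> real^('n option)^'n \<Rightarrow> real \<Rightarrow> real^'r^'r
     \<Rightarrow> real \<Rightarrow> real \<Rightarrow> real^('n option)^'n \<Rightarrow> ereal" where
  "bellman A0 AA c R d S \<tau> t v =
     (INF (U, z) \<in> {(U, z). continuous_on {t..\<tau>} U \<and> solves_state A0 AA c \<tau> t v U z}.
        ereal ((R \<bullet> z \<tau> + d) + 1/2 * integral {t..\<tau>} (\<lambda>s. sq_norm_wrt S (U s))))"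

text \<open>
  Continuous differentiability on the time interval times the matrix space, with one-sided time
  derivatives at the end points. The Frechet derivative in the second argument is represented by
  a matrix through the Frobenius inner product.
\<close>

definition C1_with_partials ::
  "real \<Rightarrow> (real \<Rightarrow> 'v::euclidean_space \<Rightarrow> real) \<Rightarrow> (real \<Rightarrow> 'v \<Rightarrow> real) \<Rightarrow> (real \<Rightarrow> 'v \<Rightarrow> 'v) \<Rightarrow> bool" where
  "C1_with_partials \<tau> \<Psi> \<Psi>t \<Psi>v \<longleftrightarrow>
     (\<forall>t\<in>{0..\<tau>}. \<forall>v. ((\<lambda>s. \<Psi> s v) has_real_derivative \<Psi>t t v) (at t within {0..\<tau>})
        \<and> (\<Psi> t has_derivative (\<lambda>h. \<Psi>v t v \<bullet> h)) (at v))
     \<and> continuous_on ({0..\<tau>} \<times> UNIV) (\<lambda>(t, v). \<Psi>t t v)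
     \<and> continuous_on ({0..\<tau>} \<times> UNIV) (\<lambda>(t, v). \<Psi>v t v)"

definition hjb_objective ::
  "real^'n^'n \<Rightarrow> real^'r^'n^'n \<Rightarrow> real^('n option)^'n \<Rightarrow> real^'r^'r
     \<Rightarrow> real^('n option)^'n \<Rightarrow> real^('n option)^'n \<Rightarrow> real^'r \<Rightarrow> real" where
  "hjb_objective A0 AA c S p v u = p \<bullet> state_rhs A0 AA c u v + 1/2 * sq_norm_wrt S u"

text \<open>\<open>attains_min f y\<close> expresses that the minimum of \<open>f\<close> exists and is equal to \<open>y\<close>.\<close>

definition attains_min :: "('a \<Rightarrow> real) \<Rightarrow> real \<Rightarrow> bool" where
  "attains_min f y \<longleftrightarrow> (\<exists>u. is_arg_min f (\<lambda>_. True) u \<and> f u = y)"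

definition optimal_control ::
  "real^'n^'n \<Rightarrow> real^'r^'n^'n \<Rightarrow> real^('n option)^'n \<Rightarrow> real^'r^'r
     \<Rightarrow> (real \<Rightarrow> real^('n option)^'n \<Rightarrow> real^('n option)^'n)
     \<Rightarrow> real \<Rightarrow> real^('n option)^'n \<Rightarrow> real^'r" where
  "optimal_control A0 AA c S \<Psi>v t v =
     (THE u. is_arg_min (hjb_objective A0 AA c S (\<Psi>v t v) v) (\<lambda>_. True) u)"

end

theory Submission
  imports Defs
begin

text \<open>
  Along any admissible trajectory, \<open>\<Psi>\<close> plus the running cost has derivative
  \<open>G + 1/2 * \<parallel>u - w\<parallel>\<^sup>2\<close> in the norm of the weight matrix, by completing the square; here \<open>w\<close> is
  the claimed feedback and \<open>G\<close> the left-hand side of the PDE. If \<open>G < 0\<close> somewhere, the constant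
  control equal to \<open>w\<close> there, followed after a short time by a nearly optimal control, has a cost
  below the infimum; as controls must be continuous, the switch has to be smoothed. If
  \<open>G > 0\<close> somewhere, every control loses at least a fixed amount before the state leaves a
  neighbourhood, so the infimum is not approached. Both arguments need time to spare before
  \<open>\<tau>\<close>; the case \<open>t = \<tau>\<close> follows by continuity.
\<close>

subsection \<open>Ordinary differential equations\<close>

text \<open>In the supremum norm weighted by \<open>exp (- 2 * L * (s - a))\<close>, the Picard iteration halves
  distances on the whole interval, so no gluing of local solutions is needed.\<close>

lemma lipschitz_ode_solution_exists:
  fixes f :: "real \<Rightarrow> 'a::euclidean_space \<Rightarrow> 'a"
  assumes cont: "continuous_on ({a..b} \<times> UNIV) (\<lambda>(s, y). f s y)"
    and lip: "\<And>s x y. s \<in> {a..b} \<Longrightarrow> norm (f s x - f s y) \<le> B * norm (x - y)"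
    and "a \<le> b"
  obtains x where "x a = v"
    and "\<And>s. s \<in> {a..b} \<Longrightarrow> (x has_vector_derivative f s (x s)) (at s within {a..b})"
proof -
  define L where "L = max B 1"
  have L: "L \<ge> 1" "\<And>s x y. s \<in> {a..b} \<Longrightarrow> norm (f s x - f s y) \<le> L * norm (x - y)"
    using lip by (auto simp: L_def intro: order_trans[OF lip mult_right_mono])
  have cf: "continuous_on {a..b} (\<lambda>s. f s (y s))" if "continuous_on {a..b} y" for y
  proof -
    have "continuous_on {a..b} (\<lambda>s. case (s, y s) of (s, y) \<Rightarrow> f s y)"
      by (rule continuous_on_compose2[OF cont]) (auto intro!: continuous_intros that)
    then show ?thesis by simp
  qed
  define X where "X = rec_nat (\<lambda>_. v) (\<lambda>k y s. v + integral {a..s} (\<lambda>r. f r (y r)))"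
  have X0: "X 0 = (\<lambda>_. v)"
    and XS: "X (Suc k) = (\<lambda>s. v + integral {a..s} (\<lambda>r. f r (X k r)))" for k
    by (simp_all add: X_def)
  have cX: "continuous_on {a..b} (X k)" for k
    by (induction k) (auto simp: X0 XS intro!: continuous_intros indefinite_integral_continuous_1
        integrable_continuous_real cf)
  have fint: "(\<lambda>r. f r (X k r)) integrable_on {a..s}" if "s \<in> {a..b}" for s k
    by (rule integrable_continuous_real, rule continuous_on_subset[OF cf[OF cX]]) (use that in auto)
  obtain M where M: "\<And>s. s \<in> {a..b} \<Longrightarrow> norm (X 1 s - X 0 s) \<le> M"
  proof -
    have "bounded ((\<lambda>s. X 1 s - X 0 s) ` {a..b})"
      by (intro compact_imp_bounded compact_continuous_image continuous_intros cX) auto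
    then show ?thesis using that unfolding bounded_iff by blast
  qed
  have "M \<ge> 0" using M[of a] \<open>a \<le> b\<close> by (auto intro: order_trans[OF norm_ge_zero])
  have step: "norm (X (Suc k) s - X k s) \<le> M * (1/2)^k * exp (2 * L * (s - a))"
    if "s \<in> {a..b}" for s k
    using that
  proof (induction k arbitrary: s)
    case 0
    have "M * 1 \<le> M * exp (2 * L * (s - a))"
      using \<open>M \<ge> 0\<close> L 0 by (intro mult_left_mono) auto
    then show ?case using M[OF 0] by simp
  next
    case (Suc k)
    \<comment> \<open>\<open>?E\<close> is an antiderivative of \<open>?e\<close>: integrating the
      weight divides it by \<open>2 * L\<close>, which against the Lipschitz factor \<open>L\<close>
      leaves \<open>1/2\<close> per iteration.\<close>
    let ?e = "\<lambda>r. L * (M * (1/2)^k * exp (2 * L * (r - a)))"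
    let ?E = "\<lambda>r. M * (1/2)^Suc k * exp (2 * L * (r - a))"
    have E: "(?e has_integral (?E s - ?E a)) {a..s}"
      using Suc.prems
      by (intro fundamental_theorem_of_calculus)
        (auto simp: has_real_derivative_iff_has_vector_derivative[symmetric]
          intro!: derivative_eq_intros)
    have "X (Suc (Suc k)) s - X (Suc k) s = integral {a..s} (\<lambda>r. f r (X (Suc k) r) - f r (X k r))"
      using fun_cong[OF XS[of "Suc k"], of s] fun_cong[OF XS[of k], of s]
        integral_diff[OF fint[OF Suc.prems, of "Suc k"] fint[OF Suc.prems, of k]] by simp
    also have "norm \<dots> \<le> integral {a..s} ?e"
    proof (rule integral_norm_bound_integral)
      show "(\<lambda>r. f r (X (Suc k) r) - f r (X k r)) integrable_on {a..s}"
        by (intro integrable_diff fint Suc.prems)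
      show "?e integrable_on {a..s}" using E by blast
      fix r assume "r \<in> {a..s}"
      then have r: "r \<in> {a..b}" using Suc.prems by auto
      show "norm (f r (X (Suc k) r) - f r (X k r)) \<le> ?e r"
        using L(2)[OF r] Suc.IH[OF r] L(1) by (meson mult_left_mono order_trans zero_le_one)
    qed
    also have "\<dots> = ?E s - ?E a" using E by (rule integral_unique)
    also have "\<dots> \<le> ?E s" using \<open>M \<ge> 0\<close> by simp
    finally show ?case .
  qed
  \<comment> \<open>The iterates are \<open>v\<close> plus the partial sums of their increments,
    which a geometric series dominates uniformly in \<open>s\<close>.\<close>
  have "uniformly_convergent_on {a..b} (\<lambda>n s. \<Sum>k<n. X (Suc k) s - X k s)"
  proof (rule Weierstrass_m_test')
    show "summable (\<lambda>k. M * exp (2 * L * (b - a)) * (1/2::real)^k)"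
      by (intro summable_mult summable_geometric) auto
    fix k s assume s: "s \<in> {a..b}"
    have "M * (1/2)^k * exp (2 * L * (s - a)) \<le> M * (1/2)^k * exp (2 * L * (b - a))"
      using s L \<open>M \<ge> 0\<close> by (intro mult_left_mono) auto
    then show "norm (X (Suc k) s - X k s) \<le> M * exp (2 * L * (b - a)) * (1/2)^k"
      using step[OF s, of k] by (simp add: mult_ac)
  qed
  moreover have "(\<Sum>k<n. X (Suc k) s - X k s) = X n s - v" for n s
    using sum_lessThan_telescope[of "\<lambda>k. X k s" n] by (simp add: X0)
  ultimately obtain l where l: "uniform_limit {a..b} (\<lambda>n s. X n s - v) l sequentially"
    unfolding uniformly_convergent_on_def by auto
  define x where "x s = v + l s" for s
  have x: "uniform_limit {a..b} X x sequentially"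
    using uniform_limit_add[OF uniform_limit_const[where c = "\<lambda>_. v"] l] by (simp add: x_def[abs_def])
  have cx: "continuous_on {a..b} x"
    by (rule uniform_limit_theorem[OF _ x]) (auto intro: always_eventually cX)
  \<comment> \<open>The Lipschitz bound carries uniform convergence over to the integrands, so the
    limit can be taken under the integral in the Picard recursion.\<close>
  have fx: "uniform_limit {a..b} (\<lambda>n s. f s (X n s)) (\<lambda>s. f s (x s)) sequentially"
  proof (rule uniform_limitI)
    fix e :: real assume "e > 0"
    have "\<forall>\<^sub>F n in sequentially. \<forall>s\<in>{a..b}. dist (X n s) (x s) < e / L"
      using uniform_limitD[OF x, of "e / L"] \<open>e > 0\<close> L by simp
    then show "\<forall>\<^sub>F n in sequentially. \<forall>s\<in>{a..b}. dist (f s (X n s)) (f s (x s)) < e"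
    proof eventually_elim
      case (elim n)
      show ?case
      proof
        fix s assume s: "s \<in> {a..b}"
        have "L * norm (X n s - x s) < e"
          using elim s L by (auto simp: dist_norm field_simps)
        then show "dist (f s (X n s)) (f s (x s)) < e"
          using L(2)[OF s, of "X n s" "x s"] by (simp add: dist_norm)
      qed
    qed
  qed
  have xi: "x s = v + integral {a..s} (\<lambda>r. f r (x r))" if s: "s \<in> {a..b}" for s
  proof -
    have ul: "uniform_limit {a..s} (\<lambda>n r. f r (X n r)) (\<lambda>r. f r (x r)) sequentially"
      by (rule uniform_limit_on_subset[OF fx]) (use s in auto)
    have "continuous_on {a..s} (\<lambda>r. f r (X n r))" for n
      by (rule continuous_on_subset[OF cf[OF cX]]) (use s in auto)
    then have "(\<lambda>n. integral {a..s} (\<lambda>r. f r (X n r))) \<longlonglongrightarrow> integral {a..s} (\<lambda>r. f r (x r))"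
    proof (rule uniform_limit_integral[OF ul _ trivial_limit_sequentially])
      fix I J assume IJ: "\<And>n. ((\<lambda>r. f r (X n r)) has_integral I n) {a..s}"
        "((\<lambda>r. f r (x r)) has_integral J) {a..s}" "I \<longlonglongrightarrow> J"
      have "integral {a..s} (\<lambda>r. f r (X n r)) = I n" for n by (rule integral_unique[OF IJ(1)])
      moreover have "integral {a..s} (\<lambda>r. f r (x r)) = J" by (rule integral_unique[OF IJ(2)])
      ultimately show ?thesis using IJ(3) by simp
    qed
    then have "(\<lambda>n. X (Suc n) s) \<longlonglongrightarrow> v + integral {a..s} (\<lambda>r. f r (x r))"
      unfolding XS by (intro tendsto_intros)
    moreover have "(\<lambda>n. X (Suc n) s) \<longlonglongrightarrow> x s"
      using tendsto_uniform_limitI[OF x s] by (rule LIMSEQ_Suc)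
    ultimately show ?thesis by (rule LIMSEQ_unique[rotated])
  qed
  show thesis
  proof (rule that)
    show "x a = v" using xi[of a] \<open>a \<le> b\<close> by simp
    fix s assume s: "s \<in> {a..b}"
    have "((\<lambda>s. v + integral {a..s} (\<lambda>r. f r (x r))) has_vector_derivative 0 + f s (x s))
        (at s within {a..b})"
      by (intro derivative_intros integral_has_vector_derivative cf cx s)
    then show "(x has_vector_derivative f s (x s)) (at s within {a..b})"
      using s xi by (auto intro: has_vector_derivative_transform)
  qed
qed

text \<open>The square of the norm is differentiable where the norm itself need not be.\<close>

lemma norm_square_gronwall:
  fixes e :: "real \<Rightarrow> 'a::euclidean_space"
  assumes "a \<le> b" and "B \<ge> 0"
    and e: "\<And>s. s \<in> {a..b} \<Longrightarrow> (e has_vector_derivative e' s) (at s within {a..b})"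
    and bound: "\<And>s. s \<in> {a..b} \<Longrightarrow> norm (e' s) \<le> B * norm (e s) + C"
  shows "(norm (e b))\<^sup>2 \<le> exp ((2 * B + 1) * (b - a)) * ((norm (e a))\<^sup>2 + C\<^sup>2 * (b - a))"
proof -
  \<comment> \<open>The rate \<open>2 * B\<close> comes from differentiating the square; the extra
    \<open>1\<close> absorbs the mixed term, as
    \<open>2 * C * norm (e s) \<le> (norm (e s))\<^sup>2 + C\<^sup>2\<close>.\<close>
  define k where "k = 2 * B + 1"
  let ?g = "\<lambda>s. exp (- (k * (s - a))) * (e s \<bullet> e s) - C\<^sup>2 * (s - a)"
  let ?g' = "\<lambda>s. exp (- (k * (s - a))) * (2 * (e s \<bullet> e' s) - k * (e s \<bullet> e s)) - C\<^sup>2"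
  have g: "(?g has_real_derivative ?g' s) (at s within {a..b})" if "s \<in> {a..b}" for s
    using e[OF that]
    unfolding has_real_derivative_iff_has_vector_derivative has_vector_derivative_def
    by (auto intro!: derivative_eq_intros simp: algebra_simps inner_commute)
  have "?g b \<le> ?g a"
  proof (rule DERIV_nonpos_imp_decreasing_open[OF \<open>a \<le> b\<close>])
    show "continuous_on {a..b} ?g" by (rule DERIV_continuous_on) (rule g)
    fix s assume s: "a < s" "s < b"
    then have s': "s \<in> {a..b}" by simp
    have "2 * (e s \<bullet> e' s) \<le> 2 * (norm (e s) * (B * norm (e s) + C))"
      using norm_cauchy_schwarz[of "e s" "e' s"] bound[OF s']
      by (smt (verit) mult_left_mono norm_ge_zero)
    also have "\<dots> \<le> k * (e s \<bullet> e s) + C\<^sup>2"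
      using zero_le_power2[of "norm (e s) - C"]
      by (simp add: k_def dot_square_norm power2_eq_square algebra_simps)
    finally have le: "2 * (e s \<bullet> e' s) - k * (e s \<bullet> e s) \<le> C\<^sup>2" by simp
    have "exp (- (k * (s - a))) \<le> 1" using s \<open>B \<ge> 0\<close> by (simp add: k_def)
    then have "exp (- (k * (s - a))) * C\<^sup>2 \<le> C\<^sup>2" by (simp add: mult_left_le_one_le)
    moreover have "exp (- (k * (s - a))) * (2 * (e s \<bullet> e' s) - k * (e s \<bullet> e s))
        \<le> exp (- (k * (s - a))) * C\<^sup>2"
      using le by (intro mult_left_mono) auto
    ultimately have "?g' s \<le> 0" by linarith
    moreover have "(?g has_real_derivative ?g' s) (at s)"
      using g[OF s'] s by (simp add: at_within_Icc_at)
    ultimately show "\<exists>y. (?g has_real_derivative y) (at s) \<and> y \<le> 0" by blast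
  qed
  then have "exp (- (k * (b - a))) * (norm (e b))\<^sup>2 \<le> (norm (e a))\<^sup>2 + C\<^sup>2 * (b - a)"
    by (simp add: dot_square_norm)
  then have "exp (k * (b - a)) * (exp (- (k * (b - a))) * (norm (e b))\<^sup>2)
      \<le> exp (k * (b - a)) * ((norm (e a))\<^sup>2 + C\<^sup>2 * (b - a))"
    by (intro mult_left_mono) auto
  then show ?thesis by (simp add: k_def mult.assoc[symmetric] exp_add[symmetric])
qed

subsection \<open>Bilinear control problems with a smooth value function\<close>

text \<open>The partial derivatives combine into a joint one because the one in \<open>v\<close> is
  continuous; the curve \<open>s \<mapsto> (s, z s)\<close> is then inserted. Derivatives within
  \<open>S\<close> cover the one-sided ones at end points.\<close>

lemma C1_with_partials_chain_rule:
  assumes C1: "C1_with_partials \<tau> \<Psi> \<Psi>t \<Psi>v"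
    and S: "S \<subseteq> {0..\<tau>}" "s \<in> S"
    and z: "(z has_vector_derivative z') (at s within S)"
  shows "((\<lambda>s. \<Psi> s (z s)) has_real_derivative \<Psi>t s (z s) + \<Psi>v s (z s) \<bullet> z') (at s within S)"
proof -
  have s: "s \<in> {0..\<tau>}" using S by auto
  \<comment> \<open>The gradient becomes a family of bounded linear functionals, the form in which
    \<open>has_derivative_partialsI\<close> takes the continuous partial derivative.\<close>
  have "continuous_on ({0..\<tau>} \<times> UNIV) (\<lambda>p. blinfun_inner_right (case p of (t, v) \<Rightarrow> \<Psi>v t v))"
    using C1 unfolding C1_with_partials_def
    by (intro bounded_linear.continuous_on[OF bounded_linear_blinfun_inner_right]) auto
  then have cont: "continuous (at (s, z s) within {0..\<tau>} \<times> UNIV)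
      (\<lambda>(t, v). blinfun_inner_right (\<Psi>v t v))"
    using s by (auto simp: continuous_on_eq_continuous_within case_prod_unfold)
  have "((\<lambda>(t, v). \<Psi> t v) has_derivative
      (\<lambda>(ht, hv). \<Psi>t s (z s) * ht + blinfun_inner_right (\<Psi>v s (z s)) hv))
      (at (s, z s) within {0..\<tau>} \<times> UNIV)"
    by (rule has_derivative_partialsI[OF _ _ cont])
      (use C1 s in \<open>auto simp: C1_with_partials_def has_field_derivative_def\<close>)
  then have \<Psi>: "((\<lambda>(t, v). \<Psi> t v) has_derivative (\<lambda>(ht, hv). \<Psi>t s (z s) * ht + \<Psi>v s (z s) \<bullet> hv))
      (at (s, z s) within (\<lambda>s. (s, z s)) ` S)"
    unfolding blinfun_inner_right.rep_eq by (rule has_derivative_subset) (use S in auto)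
  have "((\<lambda>s. (s, z s)) has_derivative (\<lambda>h. (h, h *\<^sub>R z'))) (at s within S)"
    using z unfolding has_vector_derivative_def by (auto intro!: derivative_eq_intros)
  from has_derivative_eq_rhs[OF has_derivative_in_compose[OF this \<Psi>]] show ?thesis
    by (simp add: has_field_derivative_def fun_eq_iff algebra_simps)
qed

section \<open>Admissible trajectories and their cost\<close>

locale bilinear_control_problem =
  fixes A :: "'v::euclidean_space \<Rightarrow> 'v" and B :: "'u::euclidean_space \<Rightarrow> 'v \<Rightarrow> 'v" and c :: 'v
    and q :: "'u \<Rightarrow> real" and g :: "'v \<Rightarrow> real" and \<tau> :: real
  assumes A: "bounded_linear A" and B: "bounded_bilinear B"
    and q: "continuous_on UNIV q" and g: "continuous_on UNIV g"
begin

definition drift :: "'u \<Rightarrow> 'v \<Rightarrow> 'v" where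
  "drift u y = A y + B u y + c"

definition admissible :: "real \<Rightarrow> 'v \<Rightarrow> (real \<Rightarrow> 'u) \<Rightarrow> (real \<Rightarrow> 'v) \<Rightarrow> bool" where
  "admissible t v U z \<longleftrightarrow> continuous_on {t..\<tau>} U \<and> z t = v \<and>
     (\<forall>s\<in>{t..\<tau>}. (z has_vector_derivative drift (U s) (z s)) (at s within {t..\<tau>}))"

definition cost :: "real \<Rightarrow> (real \<Rightarrow> 'u) \<Rightarrow> (real \<Rightarrow> 'v) \<Rightarrow> real" where
  "cost t U z = g (z \<tau>) + integral {t..\<tau>} (\<lambda>s. q (U s))"

lemma continuous_on_drift [continuous_intros]:
  assumes "continuous_on S u" "continuous_on S y"
  shows "continuous_on S (\<lambda>x. drift (u x) (y x))"
  unfolding drift_def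
  by (intro continuous_intros bounded_linear.continuous_on[OF A] bounded_bilinear.continuous_on[OF B]
      assms)

lemma continuous_on_running_cost [continuous_intros]:
  "continuous_on S u \<Longrightarrow> continuous_on S (\<lambda>x. q (u x))"
  by (rule continuous_on_compose2[OF q]) auto

lemma drift_control_diff:
  "drift u y - drift w y = B (u - w) y"
  by (simp add: drift_def bounded_bilinear.diff_left[OF B])

lemma drift_lipschitz:
  fixes r :: real
  obtains L where "L \<ge> 0"
    and "\<And>(u :: 'u) x y. norm u \<le> r \<Longrightarrow> norm (drift u x - drift u y) \<le> L * norm (x - y)"
proof -
  obtain KA where KA: "KA > 0" "\<And>x. norm (A x) \<le> norm x * KA"
    using bounded_linear.pos_bounded[OF A] by blast
  obtain KB where KB: "KB > 0" "\<And>u x. norm (B u x) \<le> norm u * norm x * KB"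
    using bounded_bilinear.pos_bounded[OF B] by blast
  show thesis
  proof
    \<comment> \<open>The absolute value keeps the constant nonnegative even for negative
      \<open>r\<close>, when no control qualifies.\<close>
    show "KA + KB * \<bar>r\<bar> \<ge> 0" using KA KB by simp
    fix u :: 'u and x y :: 'v assume u: "norm u \<le> r"
    have "drift u x - drift u y = A (x - y) + B u (x - y)"
      by (simp add: drift_def linear_diff[OF bounded_linear.linear[OF A]] bounded_bilinear.diff_right[OF B])
    also have "norm \<dots> \<le> norm (x - y) * KA + norm u * norm (x - y) * KB"
      using KA(2)[of "x - y"] KB(2)[of u "x - y"] by (intro norm_triangle_le) simp
    also have "norm u * norm (x - y) * KB \<le> \<bar>r\<bar> * norm (x - y) * KB"
      using u KB by (intro mult_right_mono) auto
    finally show "norm (drift u x - drift u y) \<le> (KA + KB * \<bar>r\<bar>) * norm (x - y)"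
      by (simp add: algebra_simps)
  qed
qed

text \<open>A continuous control on a compact interval is bounded, so one Lipschitz constant for the
  drift serves at all times and the solution exists up to \<open>\<tau>\<close>.\<close>

lemma admissible_exists:
  assumes U: "continuous_on {t..\<tau>} U" and "t \<le> \<tau>"
  obtains z where "admissible t v U z"
proof -
  have "bounded (U ` {t..\<tau>})"
    by (intro compact_imp_bounded compact_continuous_image U) auto
  then obtain r where r: "\<And>s. s \<in> {t..\<tau>} \<Longrightarrow> norm (U s) \<le> r"
    unfolding bounded_iff by blast
  obtain L where L: "L \<ge> 0"
    "\<And>(u :: 'u) x y. norm u \<le> r \<Longrightarrow> norm (drift u x - drift u y) \<le> L * norm (x - y)"
    by (rule drift_lipschitz[of r]) blast
  have "continuous_on ({t..\<tau>} \<times> UNIV) (\<lambda>(s, y). drift (U s) y)"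
    unfolding case_prod_unfold
    by (intro continuous_intros continuous_on_compose2[OF U]) auto
  then obtain z where "z t = v"
    "\<And>s. s \<in> {t..\<tau>} \<Longrightarrow> (z has_vector_derivative drift (U s) (z s)) (at s within {t..\<tau>})"
    by (rule lipschitz_ode_solution_exists[OF _ L(2)[OF r] \<open>t \<le> \<tau>\<close>]) auto
  with U have "admissible t v U z" unfolding admissible_def by blast
  then show thesis by (rule that)
qed

lemma admissible_continuous: "admissible t v U z \<Longrightarrow> continuous_on {t..\<tau>} z"
  unfolding admissible_def continuous_on_eq_continuous_within
  by (auto intro: has_vector_derivative_continuous)

lemma admissible_derivative:
  assumes "admissible t v U z" "S \<subseteq> {t..\<tau>}" "s \<in> S"
  shows "(z has_vector_derivative drift (U s) (z s)) (at s within S)"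
  using assms by (auto simp: admissible_def intro: has_vector_derivative_within_subset)

lemma admissible_restrict:
  assumes "admissible t v U z" "t \<le> s"
  shows "admissible s (z s) U z"
  using assms admissible_derivative[OF assms(1), of "{s..\<tau>}"]
  by (auto simp: admissible_def intro: continuous_on_subset)

lemma running_cost_integrable:
  assumes "admissible t v U z" "t \<le> a" "b \<le> \<tau>"
  shows "(\<lambda>s. q (U s)) integrable_on {a..b}"
  using assms unfolding admissible_def
  by (intro integrable_continuous_real continuous_intros) (auto intro: continuous_on_subset)

lemma cost_split:
  assumes "admissible t v U z" "t \<le> s" "s \<le> \<tau>"
  shows "cost t U z = integral {t..s} (\<lambda>s. q (U s)) + cost s U z"
  using Henstock_Kurzweil_Integration.integral_combine[OF assms(2,3) running_cost_integrable[OF assms(1)]]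
  by (simp add: cost_def)

end

section \<open>Continuous approximation of a switch between two controls\<close>

context bilinear_control_problem
begin

text \<open>The switch from \<open>u\<close> to \<open>U'\<close> at time \<open>s\<close> is discontinuous in general. It is bridged on
  \<open>{s - \<delta>..s}\<close> by a linear ramp; the resulting change of the state at time \<open>s\<close>, and hence
  at time \<open>\<tau>\<close>, is of the order of \<open>\<surd>\<delta>\<close>.\<close>

lemma switching_control_approximation:
  assumes "t < s" "s \<le> \<tau>"
    and z: "admissible t v (\<lambda>_. u) z" and z': "admissible s (z s) U' z'"
  obtains C D where "\<And>\<delta>. 0 < \<delta> \<Longrightarrow> \<delta> \<le> s - t \<Longrightarrow> \<exists>U y. admissible t v U y \<and>
      (norm (y \<tau> - z' \<tau>))\<^sup>2 \<le> C * \<delta> \<and>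
      integral {t..\<tau>} (\<lambda>r. q (U r)) \<le> (s - t) * q u + integral {s..\<tau>} (\<lambda>r. q (U' r)) + D * \<delta>"
proof -
  have U': "continuous_on {s..\<tau>} U'" using z' by (simp add: admissible_def)
  have "bounded (U' ` {s..\<tau>})"
    by (intro compact_imp_bounded compact_continuous_image U') auto
  then obtain b0 where b0: "\<And>r. r \<in> {s..\<tau>} \<Longrightarrow> norm (U' r) \<le> b0" unfolding bounded_iff by blast
  \<comment> \<open>A bound for both controls; it also holds on the ramp, which consists of convex
    combinations of their values.\<close>
  define b where "b = max b0 (norm u)"
  have b: "norm u \<le> b" "\<And>r. r \<in> {s..\<tau>} \<Longrightarrow> norm (U' r) \<le> b" "b \<ge> 0"
    using b0 by (force simp: b_def le_max_iff_disj)+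
  have "bounded (q ` cball 0 b)"
    by (intro compact_imp_bounded compact_continuous_image continuous_on_subset[OF q]) auto
  then obtain Q where "\<forall>w\<in>cball 0 b. \<bar>q w\<bar> \<le> Q" unfolding bounded_iff by auto
  then have Q: "\<bar>q w\<bar> \<le> Q" if "norm w \<le> b" for w using that by simp
  have "bounded (z ` {t..\<tau>})"
    by (intro compact_imp_bounded compact_continuous_image admissible_continuous[OF z]) auto
  then obtain Z where Z: "\<And>r. r \<in> {t..\<tau>} \<Longrightarrow> norm (z r) \<le> Z" unfolding bounded_iff by blast
  obtain L where L: "L \<ge> 0"
    "\<And>(w :: 'u) x y. norm w \<le> b \<Longrightarrow> norm (drift w x - drift w y) \<le> L * norm (x - y)"
    by (rule drift_lipschitz[of b]) blast
  obtain KB where KB: "KB > 0" "\<And>w x. norm (B w x) \<le> norm w * norm x * KB"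
    using bounded_bilinear.pos_bounded[OF B] by blast
  \<comment> \<open>\<open>F\<close> bounds the discrepancy \<open>B (U r - u) (z r)\<close> of the
    drifts on the ramp, where the controls differ by at most \<open>2 * b\<close>; \<open>E\<close>
    dominates the Gronwall factors of all subintervals.\<close>
  define F where "F = 2 * b * Z * KB"
  define E where "E = exp ((2 * L + 1) * (\<tau> - t))"
  show thesis
  proof (rule that)
    fix \<delta> :: real assume \<delta>: "0 < \<delta>" "\<delta> \<le> s - t"
    \<comment> \<open>\<open>lam\<close> rises linearly from \<open>0\<close> at
      \<open>s - \<delta>\<close> to \<open>1\<close> at \<open>s\<close>. The argument
      \<open>max r s\<close> keeps \<open>U'\<close> on the interval where it is continuous, so one
      formula gives a continuous control.\<close>
    define lam where "lam r = max 0 (min 1 ((r - (s - \<delta>)) / \<delta>))" for r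
    define U where "U r = (1 - lam r) *\<^sub>R u + lam r *\<^sub>R U' (max r s)" for r
    have lam: "0 \<le> lam r" "lam r \<le> 1" for r by (auto simp: lam_def)
    have U1: "U r = u" if "r \<le> s - \<delta>" for r
      using that \<delta> by (simp add: U_def lam_def max_def min_def field_simps)
    have U2: "U r = U' r" if "r \<ge> s" for r
    proof -
      have "1 \<le> (r - (s - \<delta>)) / \<delta>" using that \<delta> by (simp add: field_simps)
      then have "lam r = 1" by (simp add: lam_def)
      then show ?thesis using that by (simp add: U_def)
    qed
    have Ub: "norm (U r) \<le> b" if "r \<in> {t..\<tau>}" for r
    proof -
      have "norm (U r) \<le> (1 - lam r) * norm u + lam r * norm (U' (max r s))"
        unfolding U_def using lam[of r] by (intro norm_triangle_le) simp
      also have "\<dots> \<le> (1 - lam r) * b + lam r * b"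
        using lam[of r] b that assms by (intro add_mono mult_left_mono) auto
      finally show ?thesis by (simp add: algebra_simps)
    qed
    have "continuous_on {t..\<tau>} U"
      unfolding U_def[abs_def] lam_def using \<delta> assms
      by (intro continuous_intros continuous_on_compose2[OF U']) auto
    then obtain y where y: "admissible t v U y"
      using admissible_exists assms by (metis less_eq_real_def order_trans)
    have t: "t \<le> s - \<delta>" "s - \<delta> \<le> s" using \<delta> by auto
    have e: "((\<lambda>r. y r - z r) has_vector_derivative drift (U r) (y r) - drift u (z r))
        (at r within S)" if "r \<in> S" "S \<subseteq> {t..\<tau>}" for r S
      using admissible_derivative[OF y that(2,1)] admissible_derivative[OF z that(2,1)]
      by (intro derivative_intros)
    have eb: "norm (drift (U r) (y r) - drift u (z r)) \<le> L * norm (y r - z r) + norm (U r - u) * Z * KB"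
      if r: "r \<in> {t..\<tau>}" for r
    proof -
      have "drift (U r) (y r) - drift u (z r)
          = (drift (U r) (y r) - drift (U r) (z r)) + B (U r - u) (z r)"
        by (simp add: drift_control_diff[symmetric])
      also have "norm \<dots> \<le> L * norm (y r - z r) + norm (U r - u) * norm (z r) * KB"
        using L(2)[OF Ub[OF r]] KB(2) by (intro norm_triangle_le add_mono)
      also have "norm (U r - u) * norm (z r) * KB \<le> norm (U r - u) * Z * KB"
        using KB Z[OF r] by (intro mult_right_mono mult_left_mono) auto
      finally show ?thesis by simp
    qed
    \<comment> \<open>Before the ramp both states obey the same equation from the same initial
      value; the Gronwall bound with \<open>C = 0\<close> gives equality.\<close>
    have "(norm (y (s - \<delta>) - z (s - \<delta>)))\<^sup>2
        \<le> exp ((2 * L + 1) * (s - \<delta> - t)) * ((norm (y t - z t))\<^sup>2 + 0\<^sup>2 * (s - \<delta> - t))"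
    proof (rule norm_square_gronwall[OF t(1) L(1)])
      fix r assume r: "r \<in> {t..s - \<delta>}"
      show "((\<lambda>r. y r - z r) has_vector_derivative drift (U r) (y r) - drift u (z r))
          (at r within {t..s - \<delta>})"
        using r assms \<delta> by (intro e) auto
      show "norm (drift (U r) (y r) - drift u (z r)) \<le> L * norm (y r - z r) + 0"
        using eb[of r] r assms \<delta> by (simp add: U1)
    qed
    also have "y t = z t" using y z by (simp add: admissible_def)
    finally have e1: "y (s - \<delta>) - z (s - \<delta>) = 0" by simp
    have E: "exp ((2 * L + 1) * x) \<le> E" if "x \<le> \<tau> - t" for x
      using that L(1) unfolding E_def by (simp add: mult_left_mono)
    \<comment> \<open>On the ramp the discrepancy is at most \<open>F\<close> and lasts for time
      \<open>\<delta>\<close>, so the squared deviation is of order \<open>\<delta>\<close>.\<close>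
    have "(norm (y s - z s))\<^sup>2
        \<le> exp ((2 * L + 1) * (s - (s - \<delta>))) * ((norm (y (s - \<delta>) - z (s - \<delta>)))\<^sup>2 + F\<^sup>2 * (s - (s - \<delta>)))"
    proof (rule norm_square_gronwall[OF t(2) L(1)])
      fix r assume r: "r \<in> {s - \<delta>..s}"
      then have r': "r \<in> {t..\<tau>}" using assms \<delta> by auto
      show "((\<lambda>r. y r - z r) has_vector_derivative drift (U r) (y r) - drift u (z r))
          (at r within {s - \<delta>..s})"
        using r assms \<delta> by (intro e) auto
      have "norm (U r - u) \<le> 2 * b"
        using norm_triangle_ineq4[of "U r" u] Ub[OF r'] b by simp
      moreover have "Z \<ge> 0" using Z[OF r'] norm_ge_zero order_trans by blast
      ultimately have "norm (U r - u) * Z * KB \<le> F"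
        unfolding F_def using KB by (intro mult_right_mono) auto
      then show "norm (drift (U r) (y r) - drift u (z r)) \<le> L * norm (y r - z r) + F"
        using eb[OF r'] by simp
    qed
    also have "\<dots> = exp ((2 * L + 1) * \<delta>) * (F\<^sup>2 * \<delta>)" by (simp add: e1)
    also have "\<dots> \<le> E * (F\<^sup>2 * \<delta>)"
      using E[of \<delta>] \<delta> assms by (intro mult_right_mono) auto
    finally have e2: "(norm (y s - z s))\<^sup>2 \<le> E * (F\<^sup>2 * \<delta>)" .
    \<comment> \<open>After \<open>s\<close> the controls agree, so the deviation present at
      \<open>s\<close> is at most amplified by a Gronwall factor.\<close>
    have "(norm (y \<tau> - z' \<tau>))\<^sup>2
        \<le> exp ((2 * L + 1) * (\<tau> - s)) * ((norm (y s - z' s))\<^sup>2 + 0\<^sup>2 * (\<tau> - s))"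
    proof (rule norm_square_gronwall[OF assms(2) L(1)])
      fix r assume r: "r \<in> {s..\<tau>}"
      show "((\<lambda>r. y r - z' r) has_vector_derivative drift (U r) (y r) - drift (U' r) (z' r))
          (at r within {s..\<tau>})"
        using r assms
        by (intro derivative_intros admissible_derivative[OF y] admissible_derivative[OF z']) auto
      show "norm (drift (U r) (y r) - drift (U' r) (z' r)) \<le> L * norm (y r - z' r) + 0"
        using L(2)[OF b(2)[OF r]] r by (simp add: U2)
    qed
    also have "z' s = z s" using z' by (simp add: admissible_def)
    also have "exp ((2 * L + 1) * (\<tau> - s)) * ((norm (y s - z s))\<^sup>2 + 0\<^sup>2 * (\<tau> - s)) \<le> E * (E * (F\<^sup>2 * \<delta>))"
      using E[of "\<tau> - s"] e2 assms by (intro mult_mono) (auto simp: E_def)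
    finally have state: "(norm (y \<tau> - z' \<tau>))\<^sup>2 \<le> E * E * F\<^sup>2 * \<delta>" by (simp add: mult_ac)
    note int = running_cost_integrable[OF y]
    have "integral {t..\<tau>} (\<lambda>r. q (U r)) = integral {t..s - \<delta>} (\<lambda>r. q (U r))
        + integral {s - \<delta>..s} (\<lambda>r. q (U r)) + integral {s..\<tau>} (\<lambda>r. q (U r))"
    proof -
      have "integral {t..s - \<delta>} (\<lambda>r. q (U r)) + integral {s - \<delta>..s} (\<lambda>r. q (U r))
          = integral {t..s} (\<lambda>r. q (U r))"
        by (rule Henstock_Kurzweil_Integration.integral_combine[OF t]) (use assms in \<open>auto intro: int\<close>)
      moreover have "integral {t..s} (\<lambda>r. q (U r)) + integral {s..\<tau>} (\<lambda>r. q (U r))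
          = integral {t..\<tau>} (\<lambda>r. q (U r))"
        by (rule Henstock_Kurzweil_Integration.integral_combine) (use assms in \<open>auto intro: int\<close>)
      ultimately show ?thesis by linarith
    qed
    moreover have "integral {t..s - \<delta>} (\<lambda>r. q (U r)) = (s - t) * q u - \<delta> * q u"
    proof -
      have "integral {t..s - \<delta>} (\<lambda>r. q (U r)) = integral {t..s - \<delta>} (\<lambda>r. q u)"
        using U1 by (intro integral_cong) auto
      also have "\<dots> = (s - t) * q u - \<delta> * q u" using t by (simp add: algebra_simps)
      finally show ?thesis .
    qed
    moreover have "\<delta> * (- q u) \<le> \<delta> * Q"
      using Q[OF b(1)] \<delta> by (intro mult_left_mono) auto
    moreover have "integral {s..\<tau>} (\<lambda>r. q (U r)) = integral {s..\<tau>} (\<lambda>r. q (U' r))"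
      by (rule integral_cong) (simp add: U2)
    moreover have "integral {s - \<delta>..s} (\<lambda>r. q (U r)) \<le> \<delta> * Q"
    proof -
      have "q (U r) \<le> Q" if "r \<in> {s - \<delta>..s}" for r
        using Q[OF Ub[of r]] that t assms by auto
      then have "integral {s - \<delta>..s} (\<lambda>r. q (U r)) \<le> integral {s - \<delta>..s} (\<lambda>r. Q)"
        by (intro integral_le int) (use t assms in auto)
      then show ?thesis using \<delta> by simp
    qed
    \<comment> \<open>One \<open>\<delta> * Q\<close> pays for the ramp, the other for counting the
      cost of \<open>u\<close> over the time \<open>s - t\<close> instead of
      \<open>s - t - \<delta>\<close>.\<close>
    ultimately have "integral {t..\<tau>} (\<lambda>r. q (U r))
        \<le> (s - t) * q u + integral {s..\<tau>} (\<lambda>r. q (U' r)) + 2 * (\<delta> * Q)"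
      by linarith
    also have "2 * (\<delta> * Q) = 2 * Q * \<delta>" by simp
    finally have "integral {t..\<tau>} (\<lambda>r. q (U r))
        \<le> (s - t) * q u + integral {s..\<tau>} (\<lambda>r. q (U' r)) + 2 * Q * \<delta>" .
    with y state show "\<exists>U y. admissible t v U y \<and> (norm (y \<tau> - z' \<tau>))\<^sup>2 \<le> E * E * F\<^sup>2 * \<delta> \<and>
      integral {t..\<tau>} (\<lambda>r. q (U r))
        \<le> (s - t) * q u + integral {s..\<tau>} (\<lambda>r. q (U' r)) + 2 * Q * \<delta>"
      by blast
  qed
qed

end

text \<open>The first two assumptions characterise \<open>\<Psi>\<close> as the infimum of the costs
  in terms of real numbers, which includes its finiteness.\<close>

locale smooth_value_function = bilinear_control_problem A B c q g \<tau>
  for A :: "'v::euclidean_space \<Rightarrow> 'v" and B :: "'u::euclidean_space \<Rightarrow> 'v \<Rightarrow> 'v" and c q g \<tau> +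
  fixes \<Psi> \<Psi>t :: "real \<Rightarrow> 'v \<Rightarrow> real" and \<Psi>v :: "real \<Rightarrow> 'v \<Rightarrow> 'v"
  assumes value_le_cost: "\<And>t v U z. t \<in> {0..\<tau>} \<Longrightarrow> admissible t v U z \<Longrightarrow> \<Psi> t v \<le> cost t U z"
    and near_optimal: "\<And>t v e. t \<in> {0..\<tau>} \<Longrightarrow> 0 < e \<Longrightarrow>
      \<exists>U z. admissible t v U z \<and> cost t U z < \<Psi> t v + e"
    and C1: "C1_with_partials \<tau> \<Psi> \<Psi>t \<Psi>v"
begin

text \<open>This is the dynamic programming inequality for a constant first stage. The switched
  control may jump, but controls with ever shorter ramps have terminal states converging to
  \<open>z' \<tau>\<close>, and continuity of \<open>g\<close> passes their cost bound to the
  limit.\<close>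

lemma value_le_switched_cost:
  assumes "0 \<le> t" "t < s" "s \<le> \<tau>"
    and z: "admissible t v (\<lambda>_. u) z" and z': "admissible s (z s) U' z'"
  shows "\<Psi> t v \<le> (s - t) * q u + cost s U' z'"
proof -
  obtain C D where CD: "\<And>\<delta>. 0 < \<delta> \<Longrightarrow> \<delta> \<le> s - t \<Longrightarrow> \<exists>U y. admissible t v U y \<and>
      (norm (y \<tau> - z' \<tau>))\<^sup>2 \<le> C * \<delta> \<and>
      integral {t..\<tau>} (\<lambda>r. q (U r)) \<le> (s - t) * q u + integral {s..\<tau>} (\<lambda>r. q (U' r)) + D * \<delta>"
    by (rule switching_control_approximation[OF assms(2-5)]) blast
  define \<delta> where "\<delta> n = (s - t) * inverse (real (Suc n))" for n
  have "inverse (real (Suc n)) \<le> 1" for n by (simp add: inverse_le_1_iff)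
  then have "\<delta> n > 0 \<and> \<delta> n \<le> s - t" for n
    using \<open>t < s\<close> unfolding \<delta>_def by (intro conjI mult_pos_pos mult_left_le) auto
  then have "\<exists>U y. admissible t v U y \<and> (norm (y \<tau> - z' \<tau>))\<^sup>2 \<le> C * \<delta> n \<and>
      integral {t..\<tau>} (\<lambda>r. q (U r)) \<le> (s - t) * q u + integral {s..\<tau>} (\<lambda>r. q (U' r)) + D * \<delta> n" for n
    by (intro CD) auto
  then obtain U y where y: "\<And>n. admissible t v (U n) (y n)"
    "\<And>n. (norm (y n \<tau> - z' \<tau>))\<^sup>2 \<le> C * \<delta> n"
    "\<And>n. integral {t..\<tau>} (\<lambda>r. q (U n r))
      \<le> (s - t) * q u + integral {s..\<tau>} (\<lambda>r. q (U' r)) + D * \<delta> n"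
    by metis
  have \<delta>: "\<delta> \<longlonglongrightarrow> 0"
    using tendsto_mult_right_zero[OF LIMSEQ_inverse_real_of_nat, of "s - t"]
    by (simp add: \<delta>_def[abs_def])
  have "(\<lambda>n. sqrt (C * \<delta> n)) \<longlonglongrightarrow> sqrt (C * 0)" by (intro tendsto_intros \<delta>)
  then have sqrt: "(\<lambda>n. sqrt (C * \<delta> n)) \<longlonglongrightarrow> 0" by (simp only: mult_zero_right real_sqrt_zero)
  have "norm (y n \<tau> - z' \<tau>) \<le> sqrt (C * \<delta> n)" for n
    by (rule real_le_rsqrt) (rule y(2))
  then have "(\<lambda>n. y n \<tau> - z' \<tau>) \<longlonglongrightarrow> 0"
    by (rule Lim_null_comparison[OF always_eventually[OF allI] sqrt])
  then have "(\<lambda>n. y n \<tau>) \<longlonglongrightarrow> z' \<tau>" by (rule LIM_zero_cancel)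
  then have "(\<lambda>n. g (y n \<tau>)) \<longlonglongrightarrow> g (z' \<tau>)"
    by (rule continuous_on_tendsto_compose[OF g]) auto
  then have "(\<lambda>n. g (y n \<tau>) + ((s - t) * q u + integral {s..\<tau>} (\<lambda>r. q (U' r)) + D * \<delta> n))
      \<longlonglongrightarrow> g (z' \<tau>) + ((s - t) * q u + integral {s..\<tau>} (\<lambda>r. q (U' r)) + D * 0)"
    by (intro tendsto_intros \<delta>)
  moreover have "\<Psi> t v \<le> g (y n \<tau>) + ((s - t) * q u + integral {s..\<tau>} (\<lambda>r. q (U' r)) + D * \<delta> n)" for n
    using value_le_cost[OF _ y(1)[of n]] y(3)[of n] assms by (simp add: cost_def)
  ultimately have "\<Psi> t v \<le> g (z' \<tau>) + ((s - t) * q u + integral {s..\<tau>} (\<lambda>r. q (U' r)) + D * 0)"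
    by (intro LIMSEQ_le_const) auto
  then show ?thesis by (simp add: cost_def)
qed

text \<open>Were the expression negative, value plus running cost would drop strictly along the
  constant control \<open>u\<close> just after \<open>t\<close>; a nearly optimal continuation would
  then cost less than the infimum.\<close>

lemma hamiltonian_nonneg:
  assumes t: "t \<in> {0..<\<tau>}"
  shows "0 \<le> \<Psi>t t v + \<Psi>v t v \<bullet> drift u v + q u"
proof (rule ccontr)
  assume neg: "\<not> ?thesis"
  obtain z where z: "admissible t v (\<lambda>_. u) z"
    by (rule admissible_exists[of t "\<lambda>_. u" v]) (use t in auto)
  have zt: "z t = v" using z by (simp add: admissible_def)
  have "((\<lambda>s. \<Psi> s (z s)) has_real_derivative \<Psi>t t (z t) + \<Psi>v t (z t) \<bullet> drift u (z t))
      (at t within {t..\<tau>})"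
    by (rule C1_with_partials_chain_rule[OF C1 _ _ admissible_derivative[OF z]]) (use t in auto)
  then have "((\<lambda>s. \<Psi> s (z s) + (s - t) * q u) has_real_derivative
      (\<Psi>t t (z t) + \<Psi>v t (z t) \<bullet> drift u (z t)) + q u) (at t within {t..\<tau>})"
    by (auto intro!: derivative_eq_intros)
  then have "\<exists>d > 0. \<forall>h > 0. t + h \<in> {t..\<tau>} \<longrightarrow> h < d \<longrightarrow>
      \<Psi> t (z t) + (t - t) * q u > \<Psi> (t + h) (z (t + h)) + (t + h - t) * q u"
    by (rule has_real_derivative_neg_dec_right) (use neg zt in simp)
  then obtain d where d: "d > 0" "\<And>h. h > 0 \<Longrightarrow> t + h \<in> {t..\<tau>} \<Longrightarrow> h < d \<Longrightarrow>
      \<Psi> t v > \<Psi> (t + h) (z (t + h)) + h * q u"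
    using zt by auto
  define h where "h = min (d / 2) (\<tau> - t)"
  have h: "h > 0" "t + h \<in> {t..\<tau>}" "h < d" using d(1) t by (auto simp: h_def)
  \<comment> \<open>\<open>e\<close> is the drop itself, so a continuation that is optimal up to
    less than \<open>e\<close> already costs too little.\<close>
  define e where "e = \<Psi> t v - (\<Psi> (t + h) (z (t + h)) + h * q u)"
  have "e > 0" using d(2)[OF h] by (simp add: e_def)
  moreover have "t + h \<in> {0..\<tau>}" using h t by auto
  ultimately obtain U' z' where z': "admissible (t + h) (z (t + h)) U' z'"
    "cost (t + h) U' z' < \<Psi> (t + h) (z (t + h)) + e"
    using near_optimal by blast
  have "\<Psi> t v \<le> (t + h - t) * q u + cost (t + h) U' z'"
    by (rule value_le_switched_cost[OF _ _ _ z z'(1)]) (use h t in auto)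
  with z'(2) show False by (simp add: e_def)
qed

text \<open>\<open>G t v\<close> plays the role of the minimum of the right-hand side of the equation (with the time
  derivative added) and \<open>w t v\<close> that of the minimiser. While the state remains in a
  small ball, the cost gain per unit time exceeds a constant and also a multiple of the speed of
  the state, whatever the size of the control. So if the state leaves the ball early, it has
  still incurred a fixed cost.\<close>

lemma hamiltonian_minimum_nonpos:
  fixes w :: "real \<Rightarrow> 'v \<Rightarrow> 'u"
  assumes G: "continuous_on ({0..\<tau>} \<times> UNIV) (\<lambda>(t, v). G t v)"
    and w: "continuous_on ({0..\<tau>} \<times> UNIV) (\<lambda>(t, v). w t v)"
    and "m > 0"
    and coercive: "\<And>t v u. t \<in> {0..\<tau>} \<Longrightarrow>
      G t v + m * (norm (u - w t v))\<^sup>2 \<le> \<Psi>t t v + \<Psi>v t v \<bullet> drift u v + q u"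
    and t: "t \<in> {0..<\<tau>}"
  shows "G t v \<le> 0"
proof (rule ccontr)
  assume "\<not> G t v \<le> 0"
  define \<eta> where "\<eta> = G t v / 2"
  have \<eta>: "\<eta> > 0" "G t v > \<eta>" using \<open>\<not> G t v \<le> 0\<close> by (auto simp: \<eta>_def)
  obtain r where r: "r > 0"
    "\<And>s y. s \<in> {0..\<tau>} \<Longrightarrow> dist (s, y) (t, v) < r \<Longrightarrow> G s y > \<eta>"
  proof -
    obtain d where d: "d > 0" "\<forall>p\<in>{0..\<tau>} \<times> UNIV. dist p (t, v) < d \<longrightarrow>
        dist (case p of (s, y) \<Rightarrow> G s y) (case (t, v) of (s, y) \<Rightarrow> G s y) < \<eta>"
      using G[unfolded continuous_on_iff, rule_format, of "(t, v)" \<eta>] t \<eta>(1) by auto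
    have "G s y > \<eta>" if "s \<in> {0..\<tau>}" "dist (s, y) (t, v) < d" for s y
    proof -
      have "dist (G s y) (G t v) < \<eta>" using d(2) that by force
      moreover have "G t v = 2 * \<eta>" by (simp add: \<eta>_def)
      ultimately show ?thesis unfolding dist_real_def by linarith
    qed
    then show thesis using that d(1) by blast
  qed
  \<comment> \<open>As \<open>h \<le> \<rho>\<close>, points of \<open>N\<close> are within
    \<open>h + \<rho> \<le> r / 2\<close> of \<open>(t, v)\<close>, where \<open>G\<close> still
    exceeds \<open>\<eta>\<close>.\<close>
  define \<rho> where "\<rho> = r / 4"
  define h where "h = min \<rho> (\<tau> - t)"
  have \<rho>: "\<rho> > 0" using r(1) by (simp add: \<rho>_def)
  then have h: "h > 0" "h \<le> \<rho>" "t + h \<le> \<tau>" using t by (auto simp: h_def)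
  define N where "N = {t..t + h} \<times> cball v \<rho>"
  have N: "N \<subseteq> {0..\<tau>} \<times> UNIV" using t h by (auto simp: N_def)
  have GN: "G s y \<ge> \<eta>" if "(s, y) \<in> N" for s y
  proof -
    have "dist (s, y) (t, v) \<le> \<bar>dist s t\<bar> + \<bar>dist y v\<bar>"
      unfolding dist_Pair_Pair by (rule sqrt_sum_squares_le_sum_abs)
    also have "\<dots> \<le> h + \<rho>" using that by (auto simp: N_def dist_real_def dist_commute)
    also have "\<dots> < r" using h(2) r(1) by (simp add: \<rho>_def)
    finally show ?thesis using r(2)[of s y] that N by auto
  qed
  obtain V0 where V0: "V0 \<ge> 0" "\<And>s y. (s, y) \<in> N \<Longrightarrow> norm (drift (w s y) y) \<le> V0"
  proof -
    have "continuous_on N (\<lambda>p. drift (case p of (s, y) \<Rightarrow> w s y) (snd p))"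
      by (intro continuous_intros continuous_on_subset[OF w N])
    then have "bounded ((\<lambda>p. drift (case p of (s, y) \<Rightarrow> w s y) (snd p)) ` N)"
      by (intro compact_imp_bounded compact_continuous_image)
        (auto simp: N_def intro: compact_Times)
    then obtain C where C: "\<forall>p\<in>N. norm (drift (case p of (s, y) \<Rightarrow> w s y) (snd p)) \<le> C"
      unfolding bounded_iff by auto
    have "norm (drift (w s y) y) \<le> max C 0" if "(s, y) \<in> N" for s y
      using bspec[OF C that] by simp
    then show thesis by (intro that[of "max C 0"]) auto
  qed
  obtain V1 where V1: "V1 \<ge> 0" "\<And>x y. y \<in> cball v \<rho> \<Longrightarrow> norm (B x y) \<le> V1 * norm x"
  proof -
    obtain KB where KB: "KB > 0" "\<And>x y. norm (B x y) \<le> norm x * norm y * KB"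
      using bounded_bilinear.pos_bounded[OF B] by blast
    have "norm (B x y) \<le> ((norm v + \<rho>) * KB) * norm x" if "y \<in> cball v \<rho>" for x y
    proof -
      have "norm y \<le> norm v + \<rho>"
        using that norm_triangle_ineq2[of y v] by (simp add: dist_norm norm_minus_commute)
      then have "norm x * norm y * KB \<le> norm x * (norm v + \<rho>) * KB"
        using KB by (intro mult_right_mono mult_left_mono) auto
      then show ?thesis using KB(2)[of x y] by (simp add: mult_ac)
    qed
    moreover have "(norm v + \<rho>) * KB \<ge> 0" using KB \<rho> by simp
    ultimately show thesis using that by blast
  qed
  \<comment> \<open>Small enough that \<open>\<eta>\<close> pays for the bounded part of the speed
    and \<open>m\<close> for the part quadratic in \<open>u - w s y\<close>; the summand
    \<open>1\<close> keeps the denominator positive.\<close>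
  define \<kappa> where "\<kappa> = min (\<eta> / (V0 + V1\<^sup>2 + 1)) m"
  have pos: "V0 + V1\<^sup>2 + 1 > 0" using V0(1) by (simp add: add_nonneg_pos)
  have \<kappa>: "\<kappa> > 0" "\<kappa> \<le> m" "\<kappa> * (V0 + V1\<^sup>2) \<le> \<eta>"
  proof -
    show "\<kappa> > 0" "\<kappa> \<le> m" using \<open>m > 0\<close> \<eta>(1) pos by (auto simp: \<kappa>_def)
    have "\<kappa> * (V0 + V1\<^sup>2) \<le> \<kappa> * (V0 + V1\<^sup>2 + 1)" using \<open>\<kappa> > 0\<close> by (simp add: mult_left_mono)
    also have "\<dots> \<le> \<eta> / (V0 + V1\<^sup>2 + 1) * (V0 + V1\<^sup>2 + 1)"
      using pos by (intro mult_right_mono) (auto simp: \<kappa>_def)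
    finally show "\<kappa> * (V0 + V1\<^sup>2) \<le> \<eta>" using pos by simp
  qed
  have speed: "\<kappa> * norm (drift u y) \<le> \<Psi>t s y + \<Psi>v s y \<bullet> drift u y + q u"
    and gain: "\<eta> \<le> \<Psi>t s y + \<Psi>v s y \<bullet> drift u y + q u" if sy: "(s, y) \<in> N" for s y u
  proof -
    define x where "x = norm (u - w s y)"
    have "G s y + m * x\<^sup>2 \<le> \<Psi>t s y + \<Psi>v s y \<bullet> drift u y + q u"
      using coercive[of s y u] sy N by (auto simp: x_def)
    then have D: "\<eta> + m * x\<^sup>2 \<le> \<Psi>t s y + \<Psi>v s y \<bullet> drift u y + q u"
      using GN[OF sy] by simp
    moreover have "m * x\<^sup>2 \<ge> 0" using \<open>m > 0\<close> by simp
    ultimately show "\<eta> \<le> \<Psi>t s y + \<Psi>v s y \<bullet> drift u y + q u" by linarith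
    have "drift u y = drift (w s y) y + B (u - w s y) y"
      by (simp add: drift_control_diff[symmetric])
    also have "norm \<dots> \<le> V0 + V1 * x"
      using V0(2)[OF sy] V1(2)[of y "u - w s y"] sy
      by (intro norm_triangle_le) (simp add: N_def x_def)
    \<comment> \<open>The speed grows linearly in \<open>x\<close> and the gain quadratically; this
      makes them comparable for controls of any size.\<close>
    also have "V1 * x \<le> V1\<^sup>2 + x\<^sup>2"
    proof -
      have "0 \<le> V1 * x" using V1(1) by (simp add: x_def)
      then show ?thesis using sum_squares_bound[of V1 x] by linarith
    qed
    finally have "\<kappa> * norm (drift u y) \<le> \<kappa> * (V0 + (V1\<^sup>2 + x\<^sup>2))"
      using \<kappa>(1) by (intro mult_left_mono) auto
    also have "\<dots> = \<kappa> * (V0 + V1\<^sup>2) + \<kappa> * x\<^sup>2" by (simp add: algebra_simps)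
    also have "\<dots> \<le> \<eta> + m * x\<^sup>2" using \<kappa> by (intro add_mono mult_right_mono) auto
    finally show "\<kappa> * norm (drift u y) \<le> \<Psi>t s y + \<Psi>v s y \<bullet> drift u y + q u" using D by simp
  qed
  have lower: "\<Psi> t v + min (\<eta> * h) (\<kappa> * \<rho>) \<le> cost t U z" if z: "admissible t v U z" for U z
  proof -
    have zt: "z t = v" using z by (simp add: admissible_def)
    have cz: "continuous_on {t..t + h} (\<lambda>s. norm (z s - v))"
      using h by (intro continuous_intros continuous_on_subset[OF admissible_continuous[OF z]]) auto
    \<comment> \<open>\<open>T\<close> is the first time at which the state has distance at least
      \<open>\<rho>\<close> from \<open>v\<close>, or \<open>t + h\<close> if there is none by then.
      As \<open>X\<close> is closed, this time is attained.\<close>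
    define X where "X = {s \<in> {t..t + h}. \<rho> \<le> norm (z s - v)}"
    define T where "T = (if X = {} then t + h else Inf X)"
    have bdd: "bdd_below X" unfolding X_def by (rule bdd_belowI[of _ t]) auto
    have "closed X"
      unfolding X_def using continuous_on_closed_Collect_le[OF continuous_on_const cz] by simp
    then have TX: "X \<noteq> {} \<Longrightarrow> T \<in> X"
      using closed_contains_Inf[OF _ bdd] by (simp add: T_def)
    have T: "t < T" "T \<le> t + h"
    proof -
      show "T \<le> t + h" using TX by (cases "X = {}") (auto simp: T_def X_def)
      have "T \<ge> t" using TX h by (cases "X = {}") (auto simp: T_def X_def)
      moreover have "T \<noteq> t"
      proof (cases "X = {}")
        case True
        then show ?thesis using h by (simp add: T_def)
      next
        case False
        then have "\<rho> \<le> norm (z T - v)" using TX by (simp add: X_def)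
        then show ?thesis using \<rho> zt by auto
      qed
      ultimately show "t < T" by simp
    qed
    have inN: "(s, z s) \<in> N" if "t < s" "s < T" for s
    proof -
      have "s \<notin> X" using cInf_lower[OF _ bdd, of s] that by (cases "X = {}") (auto simp: T_def)
      then show ?thesis
        using that T by (auto simp: X_def N_def dist_norm norm_minus_commute)
    qed
    \<comment> \<open>By the chain rule \<open>\<phi>'\<close> is the quantity bounded below by
      \<open>gain\<close> and \<open>speed\<close>; the growth of \<open>\<phi>\<close> measures the
      excess of the cost over the value.\<close>
    define \<phi> where "\<phi> s = \<Psi> s (z s) + integral {t..s} (\<lambda>s. q (U s))" for s
    define \<phi>' where "\<phi>' s = \<Psi>t s (z s) + \<Psi>v s (z s) \<bullet> drift (U s) (z s) + q (U s)" for s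
    have U: "continuous_on {t..T} U"
      using z T h by (auto simp: admissible_def intro: continuous_on_subset)
    have z': "(z has_vector_derivative drift (U s) (z s)) (at s within {t..T})" if "s \<in> {t..T}" for s
      by (rule admissible_derivative[OF z]) (use that T h in auto)
    have \<phi>: "(\<phi> has_vector_derivative \<phi>' s) (at s within {t..T})" if "s \<in> {t..T}" for s
    proof -
      have "((\<lambda>s. \<Psi> s (z s)) has_real_derivative
          \<Psi>t s (z s) + \<Psi>v s (z s) \<bullet> drift (U s) (z s)) (at s within {t..T})"
        using t T h by (intro C1_with_partials_chain_rule[OF C1] z' that) auto
      moreover have "((\<lambda>s. integral {t..s} (\<lambda>s. q (U s))) has_vector_derivative q (U s))
          (at s within {t..T})"
        by (intro integral_has_vector_derivative continuous_intros U that)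
      ultimately show ?thesis
        unfolding \<phi>_def[abs_def] \<phi>'_def has_real_derivative_iff_has_vector_derivative
        by (rule has_vector_derivative_add)
    qed
    have c\<phi>: "continuous_on {t..T} \<phi>" and czT: "continuous_on {t..T} z"
      unfolding continuous_on_eq_continuous_within
      by (blast intro: has_vector_derivative_continuous \<phi> z')+
    have deriv: "(\<phi> has_vector_derivative \<phi>' s) (at s)"
      "(z has_vector_derivative drift (U s) (z s)) (at s)" if "t < s" "s < T" for s
      using \<phi>[of s] z'[of s] that by (simp_all add: at_within_Icc_at)
    \<comment> \<open>Mean value comparison: \<open>\<phi>\<close> grows at least as fast as
      \<open>\<eta> * s\<close>, and in the next estimate at least as fast as
      \<open>\<kappa> *\<^sub>R z s\<close> moves.\<close>
    have "norm (\<eta> * T - \<eta> * t) \<le> \<phi> T - \<phi> t"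
    proof (rule differentiable_bound_general[OF T(1) _ c\<phi>])
      fix s assume s: "t < s" "s < T"
      show "((\<lambda>s. \<eta> * s) has_vector_derivative \<eta>) (at s)"
        unfolding has_real_derivative_iff_has_vector_derivative[symmetric]
        by (auto intro!: derivative_eq_intros)
      show "norm \<eta> \<le> \<phi>' s" using gain[OF inN[OF s], of "U s"] \<eta>(1) by (simp add: \<phi>'_def)
    qed (auto intro!: continuous_intros deriv)
    then have time: "\<eta> * (T - t) \<le> \<phi> T - \<phi> t"
      by (simp add: algebra_simps abs_le_iff)
    have "norm (\<kappa> *\<^sub>R z T - \<kappa> *\<^sub>R z t) \<le> \<phi> T - \<phi> t"
    proof (rule differentiable_bound_general[OF T(1) _ c\<phi>])
      fix s assume s: "t < s" "s < T"
      show "((\<lambda>s. \<kappa> *\<^sub>R z s) has_vector_derivative \<kappa> *\<^sub>R drift (U s) (z s)) (at s)"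
        using bounded_linear.has_vector_derivative[OF bounded_linear_scaleR_right deriv(2)[OF s]] .
      show "norm (\<kappa> *\<^sub>R drift (U s) (z s)) \<le> \<phi>' s"
        using speed[OF inN[OF s], of "U s"] \<kappa>(1) by (simp add: \<phi>'_def)
    qed (auto intro!: continuous_intros deriv czT)
    then have dist: "\<kappa> * norm (z T - v) \<le> \<phi> T - \<phi> t"
      using \<kappa>(1) by (simp add: zt scaleR_diff_right[symmetric])
    \<comment> \<open>Staying in the ball for the whole time \<open>h\<close> costs at least
      \<open>\<eta> * h\<close>; reaching distance \<open>\<rho>\<close> costs at least
      \<open>\<kappa> * \<rho>\<close>.\<close>
    have "min (\<eta> * h) (\<kappa> * \<rho>) \<le> \<phi> T - \<phi> t"
    proof (cases "X = {}")
      case True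
      then show ?thesis using time by (simp add: T_def)
    next
      case False
      then have "\<kappa> * \<rho> \<le> \<kappa> * norm (z T - v)" using TX \<kappa>(1) by (auto simp: X_def)
      then show ?thesis using dist by simp
    qed
    moreover have "\<phi> t = \<Psi> t v" by (simp add: \<phi>_def zt)
    moreover have "\<phi> T \<le> cost t U z"
    proof -
      have "\<Psi> T (z T) \<le> cost T U z"
        using t T h by (intro value_le_cost admissible_restrict[OF z]) auto
      then show ?thesis using cost_split[OF z, of T] T h by (simp add: \<phi>_def)
    qed
    ultimately show ?thesis by simp
  qed
  have "min (\<eta> * h) (\<kappa> * \<rho>) > 0" "t \<in> {0..\<tau>}" using \<eta> h \<kappa> \<rho> t by auto
  then obtain U z where "admissible t v U z" "cost t U z < \<Psi> t v + min (\<eta> * h) (\<kappa> * \<rho>)"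
    using near_optimal by blast
  then show False using lower by fastforce
qed

end

subsection \<open>Quadratic running cost and the matrix formulation\<close>

lemma inner_matrix_mult_transpose:
  fixes p :: "real^'c^'a" and M :: "real^'b^'a" and v :: "real^'c^'b"
  shows "p \<bullet> (M ** v) = (p ** transpose v) \<bullet> M"
proof -
  have "p \<bullet> (M ** v) = (\<Sum>i\<in>UNIV. \<Sum>j\<in>UNIV. \<Sum>k\<in>UNIV. p $ i $ j * v $ k $ j * M $ i $ k)"
    by (simp add: inner_vec_def matrix_matrix_mult_def sum_distrib_left mult_ac)
  also have "\<dots> = (\<Sum>i\<in>UNIV. \<Sum>k\<in>UNIV. \<Sum>j\<in>UNIV. p $ i $ j * v $ k $ j * M $ i $ k)"
    by (intro sum.cong refl sum.swap)
  also have "\<dots> = (p ** transpose v) \<bullet> M"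
    by (simp add: inner_vec_def matrix_matrix_mult_def transpose_def sum_distrib_right)
  finally show ?thesis .
qed

text \<open>Identifies the coefficient of the control in the Hamiltonian: moving \<open>v\<close>
  across the inner product leaves the pairings of \<open>p ** transpose v\<close> with the sections
  of \<open>T\<close>.\<close>

lemma inner_array_dot_mult:
  "p \<bullet> (array_dot T u ** v) = u \<bullet> star_prod (p ** transpose v) T"
  by (simp add: inner_matrix_mult_transpose array_dot_def inner_sum_right star_prod_def inner_vec_def[of u])

lemma matrix_mult_add_left:
  fixes M M' :: "real^'b^'a" and v :: "real^'c^'b"
  shows "(M + M') ** v = M ** v + M' ** v"
  by (simp add: vec_eq_iff matrix_matrix_mult_def distrib_right sum.distrib)

lemma bounded_bilinear_matrix_mult:
  "bounded_bilinear ((**) :: real^'b^'a \<Rightarrow> real^'c^'b \<Rightarrow> real^'c^'a)"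
  unfolding bilinear_conv_bounded_bilinear[symmetric] bilinear_def
  by (auto intro!: linearI simp: vec_eq_iff matrix_matrix_mult_def distrib_left distrib_right
      sum.distrib sum_distrib_left mult_ac)

lemma bounded_linear_array_dot: "bounded_linear (array_dot T)"
  unfolding linear_conv_bounded_linear[symmetric] array_dot_def
  by (rule linearI) (simp_all add: scaleR_add_left sum.distrib scaleR_sum_right)

lemma bounded_linear_star_prod: "bounded_linear (\<lambda>u. star_prod u T)"
  unfolding linear_conv_bounded_linear[symmetric] star_prod_def
  by (rule linearI) (simp_all add: vec_eq_iff inner_add_left)

lemma bounded_linear_transpose: "bounded_linear (transpose :: real^'b^'a \<Rightarrow> real^'a^'b)"
  unfolding linear_conv_bounded_linear[symmetric]
  by (rule linearI) (simp_all add: vec_eq_iff transpose_def)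

section \<open>Positive definite weights and completing the square\<close>

lemma continuous_on_sq_norm_wrt:
  "continuous_on X f \<Longrightarrow> continuous_on X (\<lambda>x. sq_norm_wrt S (f x))"
  unfolding sq_norm_wrt_def
  by (intro continuous_intros bounded_linear.continuous_on[OF matrix_vector_mul_bounded_linear])

text \<open>Positive definiteness makes the kernel trivial, and a left inverse of a square matrix is
  two-sided. As \<open>matrix_inv\<close> is defined by choice, existence of an inverse has to come
  first.\<close>

lemma pos_def_matrix_inv:
  assumes "pos_def S"
  shows "S ** matrix_inv S = mat 1"
proof -
  have "inj ((*v) S)"
  proof (rule injI)
    fix x y assume "S *v x = S *v y"
    then have "(x - y) \<bullet> (S *v (x - y)) = 0" by (simp add: matrix_vector_mult_diff_distrib)
    then show "x = y" using assms unfolding pos_def_def by (metis less_irrefl right_minus_eq)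
  qed
  then obtain T where "T ** S = mat 1" using matrix_left_invertible_injective by blast
  then have "S ** T = mat 1 \<and> T ** S = mat 1" using matrix_left_right_inverse by blast
  then have "S ** matrix_inv S = mat 1 \<and> matrix_inv S ** S = mat 1"
    unfolding matrix_inv_def by (rule someI)
  then show ?thesis ..
qed

text \<open>The constant is the minimum on the compact unit sphere; homogeneity of degree two
  extends the bound to all vectors.\<close>

lemma pos_def_coercive:
  assumes "pos_def S"
  obtains m where "m > 0" "\<And>x. m * (norm x)\<^sup>2 \<le> sq_norm_wrt S x"
proof -
  obtain x0 :: "real^'a" where "norm x0 = 1" using vector_choose_size[of 1] by auto
  then have "sphere (0 :: real^'a) 1 \<noteq> {}" by auto
  then obtain y where y: "norm y = 1" "\<And>x. norm x = 1 \<Longrightarrow> sq_norm_wrt S y \<le> sq_norm_wrt S x"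
    using continuous_attains_inf[OF compact_sphere[of "0 :: real^'a" 1], of "sq_norm_wrt S"]
      continuous_on_sq_norm_wrt[OF continuous_on_id[of "sphere (0 :: real^'a) 1"], of S]
    by auto
  show thesis
  proof
    have "y \<noteq> 0" using y(1) by auto
    then show "sq_norm_wrt S y > 0" using assms by (simp add: pos_def_def sq_norm_wrt_def)
    fix x :: "real^'a"
    show "sq_norm_wrt S y * (norm x)\<^sup>2 \<le> sq_norm_wrt S x"
    proof (cases "x = 0")
      case True
      then show ?thesis by (simp add: sq_norm_wrt_def)
    next
      case False
      then have "sq_norm_wrt S y \<le> sq_norm_wrt S (inverse (norm x) *\<^sub>R x)" by (intro y(2)) simp
      also have "\<dots> = sq_norm_wrt S x / (norm x)\<^sup>2"
        by (simp add: sq_norm_wrt_def matrix_vector_mult_scaleR power2_eq_square divide_inverse)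
      finally show ?thesis using False by (simp add: field_simps)
    qed
  qed
qed

text \<open>When the square is expanded, the two mixed terms coincide by the symmetry of
  \<open>S\<close>, and each equals \<open>u \<bullet> w\<close> because \<open>S\<close> undoes
  \<open>matrix_inv S\<close>.\<close>

lemma pos_def_complete_square:
  assumes "pos_def S"
  shows "u \<bullet> w + 1/2 * sq_norm_wrt S u
    = 1/2 * sq_norm_wrt S (u - (- (matrix_inv S *v w))) - 1/2 * sq_norm_wrt (matrix_inv S) w"
proof -
  let ?y = "matrix_inv S *v w"
  have Sy: "S *v ?y = w"
    by (simp add: matrix_vector_mul_assoc pos_def_matrix_inv[OF assms])
  have "?y \<bullet> (S *v u) = (S *v ?y) \<bullet> u"
    using assms dot_lmul_matrix[of ?y S u] by (simp add: pos_def_def transpose_matrix_vector[symmetric])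
  then have "?y \<bullet> (S *v u) = u \<bullet> w" by (simp add: Sy inner_commute)
  then show ?thesis
    by (simp add: sq_norm_wrt_def matrix_vector_right_distrib inner_add_left inner_add_right Sy
        inner_commute[of ?y w] add_divide_distrib)
qed

text \<open>Separates a control-free part from a square, so that both the minimum and the minimiser
  can be read off.\<close>

lemma hjb_objective_complete_square:
  assumes "pos_def S"
  shows "hjb_objective A0 AA c S p v u = p \<bullet> (A0 ** v + c)
      - 1/2 * sq_norm_wrt (matrix_inv S) (star_prod (p ** transpose v) AA)
      + 1/2 * sq_norm_wrt S (u - (- (matrix_inv S *v star_prod (p ** transpose v) AA)))"
proof -
  have "hjb_objective A0 AA c S p v u = p \<bullet> (A0 ** v + c)
      + (u \<bullet> star_prod (p ** transpose v) AA + 1/2 * sq_norm_wrt S u)"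
    by (simp add: hjb_objective_def state_rhs_def matrix_mult_add_left inner_add_right
        inner_array_dot_mult)
  then show ?thesis unfolding pos_def_complete_square[OF assms] by simp
qed

lemma is_arg_min_hjb_objective_iff:
  fixes A0 :: "real^'n^'n" and S :: "real^'r^'r"
  assumes "pos_def S"
  shows "is_arg_min (hjb_objective A0 AA c S p v) (\<lambda>_. True) u
    \<longleftrightarrow> u = - (matrix_inv S *v star_prod (p ** transpose v) AA)" (is "_ \<longleftrightarrow> u = ?u")
proof -
  have pos: "sq_norm_wrt S (x - ?u) > 0" if "x \<noteq> ?u" for x
  proof -
    have "x - ?u \<noteq> 0" using that by (metis right_minus_eq)
    then show ?thesis using assms unfolding pos_def_def sq_norm_wrt_def by blast
  qed
  have "hjb_objective A0 AA c S p v ?u < hjb_objective A0 AA c S p v x" if "x \<noteq> ?u" for x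
    using pos[OF that] unfolding hjb_objective_complete_square[OF assms]
    by (simp add: sq_norm_wrt_def)
  then show ?thesis unfolding is_arg_min_def by (metis less_asym)
qed

section \<open>The Bellman function as a smooth value function\<close>

lemma bellman_smooth_value_function:
  fixes A0 :: "real^'n^'n" and AA :: "real^'r^'n^'n" and S :: "real^'r^'r"
    and c R :: "real^('n option)^'n"
  assumes val: "\<And>t v. t \<in> {0..\<tau>} \<Longrightarrow> ereal (\<Psi> t v) = bellman A0 AA c R d S \<tau> t v"
    and C1: "C1_with_partials \<tau> \<Psi> \<Psi>t \<Psi>v"
  shows "smooth_value_function (\<lambda>y. A0 ** y) (\<lambda>u y. array_dot AA u ** y) c
    (\<lambda>u. 1/2 * sq_norm_wrt S u) (\<lambda>y. R \<bullet> y + d) \<tau> \<Psi> \<Psi>t \<Psi>v"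
proof -
  interpret bilinear_control_problem "\<lambda>y. A0 ** y" "\<lambda>u y. array_dot AA u ** y" c
    "\<lambda>u. 1/2 * sq_norm_wrt S u" "\<lambda>y. R \<bullet> y + d" \<tau>
  proof (rule bilinear_control_problem.intro)
    show "bounded_linear (\<lambda>y :: real^('n option)^'n. A0 ** y)"
      by (rule bounded_bilinear.bounded_linear_right[OF bounded_bilinear_matrix_mult])
    show "bounded_bilinear (\<lambda>u (y :: real^('n option)^'n). array_dot AA u ** y)"
      by (rule bounded_bilinear.comp1[OF bounded_bilinear_matrix_mult bounded_linear_array_dot])
  qed (intro continuous_intros continuous_on_sq_norm_wrt)+
  have drift: "drift u y = state_rhs A0 AA c u y" for u y
    by (simp add: drift_def state_rhs_def matrix_mult_add_left)
  have adm: "admissible t v U z \<longleftrightarrow> continuous_on {t..\<tau>} U \<and> solves_state A0 AA c \<tau> t v U z"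
    for t v U z
    unfolding admissible_def solves_state_def drift ..
  have cost: "cost t U z = (R \<bullet> z \<tau> + d) + 1/2 * integral {t..\<tau>} (\<lambda>s. sq_norm_wrt S (U s))"
    for t U z
    unfolding cost_def integral_mult_right ..
  \<comment> \<open>With the data identified, the Bellman function is the infimum of
    \<open>cost\<close> over admissible pairs; both value properties are then order properties of
    \<open>INF\<close>.\<close>
  have inf: "ereal (\<Psi> t v) = (INF (U, z) \<in> {(U, z). admissible t v U z}. ereal (cost t U z))"
    if "t \<in> {0..\<tau>}" for t v
    unfolding val[OF that] bellman_def adm cost ..
  show ?thesis
  proof unfold_locales
    fix t v U z assume "t \<in> {0..\<tau>}" "admissible t v U z"
    then have "ereal (\<Psi> t v) \<le> ereal (cost t U z)"
      unfolding inf[OF \<open>t \<in> {0..\<tau>}\<close>] by (intro INF_lower2[of "(U, z)"]) auto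
    then show "\<Psi> t v \<le> cost t U z" by simp
  next
    fix t v and e :: real assume t: "t \<in> {0..\<tau>}" and "0 < e"
    then have "(INF (U, z) \<in> {(U, z). admissible t v U z}. ereal (cost t U z)) < ereal (\<Psi> t v + e)"
      unfolding inf[OF t, symmetric] by simp
    then show "\<exists>U z. admissible t v U z \<and> cost t U z < \<Psi> t v + e"
      by (auto simp: INF_less_iff)
  qed (rule C1)
qed

text \<open>On the one-point interval the state is still \<open>v\<close> and the running cost
  vanishes, so all competitors have the same cost.\<close>

lemma bellman_terminal:
  assumes "ereal x = bellman A0 AA c R d S \<tau> \<tau> v"
  shows "x = R \<bullet> v + d"
proof -
  let ?D = "{(U, z). continuous_on {\<tau>..\<tau>} U \<and> solves_state A0 AA c \<tau> \<tau> v U z}"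
  have "solves_state A0 AA c \<tau> \<tau> v (\<lambda>_. 0) (\<lambda>_. v)"
    by (simp add: solves_state_def has_vector_derivative_def has_derivative_within_singleton_iff
        bounded_linear_scaleR_left)
  \<comment> \<open>A competitor must exist, since the infimum of the empty set is
    \<infinity>.\<close>
  then have "?D \<noteq> {}" by force
  then have "bellman A0 AA c R d S \<tau> \<tau> v = (INF p \<in> ?D. ereal (R \<bullet> v + d))"
    unfolding bellman_def by (intro INF_cong) (auto simp: solves_state_def)
  also have "\<dots> = ereal (R \<bullet> v + d)" using \<open>?D \<noteq> {}\<close> by simp
  finally show ?thesis using assms by simp
qed

text \<open>Completing the square makes \<open>G\<close> the minimum over the controls and
  \<open>w\<close> the minimiser. The two inequalities for the Hamiltonian force \<open>G\<close> to
  vanish before \<open>\<tau>\<close>, and continuity extends this to \<open>\<tau>\<close>.\<close>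

lemma smooth_bellman_hjb:
  fixes A0 :: "real^'n^'n" and AA :: "real^'r^'n^'n" and S :: "real^'r^'r"
    and c R :: "real^('n option)^'n"
  assumes "\<tau> > 0" and S: "pos_def S"
    and val: "\<And>t v. t \<in> {0..\<tau>} \<Longrightarrow> ereal (\<Psi> t v) = bellman A0 AA c R d S \<tau> t v"
    and C1: "C1_with_partials \<tau> \<Psi> \<Psi>t \<Psi>v"
    and t: "t \<in> {0..\<tau>}"
  shows "\<Psi>t t v + \<Psi>v t v \<bullet> (A0 ** v + c)
      - 1/2 * sq_norm_wrt (matrix_inv S) (star_prod (\<Psi>v t v ** transpose v) AA) = 0"
proof -
  interpret smooth_value_function "\<lambda>y. A0 ** y" "\<lambda>u y. array_dot AA u ** y" c
    "\<lambda>u. 1/2 * sq_norm_wrt S u" "\<lambda>y. R \<bullet> y + d" \<tau> \<Psi> \<Psi>t \<Psi>v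
    by (rule bellman_smooth_value_function[OF val C1])
  define w where "w t v = - (matrix_inv S *v star_prod (\<Psi>v t v ** transpose v) AA)" for t v
  define G where "G t v = \<Psi>t t v + \<Psi>v t v \<bullet> (A0 ** v + c)
      - 1/2 * sq_norm_wrt (matrix_inv S) (star_prod (\<Psi>v t v ** transpose v) AA)" for t v
  have ham: "\<Psi>t t v + \<Psi>v t v \<bullet> drift u v + 1/2 * sq_norm_wrt S u
      = G t v + 1/2 * sq_norm_wrt S (u - w t v)" for t v u
    using hjb_objective_complete_square[OF S, of A0 AA c "\<Psi>v t v" v u]
    by (simp add: hjb_objective_def state_rhs_def drift_def matrix_mult_add_left G_def w_def)
  have c\<Psi>t: "continuous_on ({0..\<tau>} \<times> UNIV) (\<lambda>p. \<Psi>t (fst p) (snd p))"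
    and c\<Psi>v: "continuous_on ({0..\<tau>} \<times> UNIV) (\<lambda>p. \<Psi>v (fst p) (snd p))"
    using C1 by (simp_all add: C1_with_partials_def case_prod_unfold)
  have star: "continuous_on ({0..\<tau>} \<times> UNIV)
      (\<lambda>p. star_prod (\<Psi>v (fst p) (snd p) ** transpose (snd p)) AA)"
    by (intro bounded_linear.continuous_on[OF bounded_linear_star_prod]
        bounded_bilinear.continuous_on[OF bounded_bilinear_matrix_mult]
        bounded_linear.continuous_on[OF bounded_linear_transpose] c\<Psi>v continuous_intros)
  have contG: "continuous_on ({0..\<tau>} \<times> UNIV) (\<lambda>(t, v). G t v)"
    unfolding G_def case_prod_unfold
    by (intro continuous_intros continuous_on_sq_norm_wrt star c\<Psi>t c\<Psi>v
        bounded_bilinear.continuous_on[OF bounded_bilinear_matrix_mult])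
  have contw: "continuous_on ({0..\<tau>} \<times> UNIV) (\<lambda>(t, v). w t v)"
    unfolding w_def case_prod_unfold
    by (intro continuous_intros bounded_linear.continuous_on[OF matrix_vector_mul_bounded_linear] star)
  obtain m where m: "m > 0" "\<And>x. m * (norm x)\<^sup>2 \<le> sq_norm_wrt S x"
    by (rule pos_def_coercive[OF S]) blast
  have zero: "G s v = 0" if s: "s \<in> {0..<\<tau>}" for s
  proof (rule antisym)
    show "G s v \<le> 0"
    proof (rule hamiltonian_minimum_nonpos[OF contG contw _ _ s])
      \<comment> \<open>The factor \<open>1/2\<close> in the running cost halves the coercivity
        constant of \<open>S\<close>.\<close>
      show "0 < m / 2" using m by simp
      fix t v u
      show "G t v + m / 2 * (norm (u - w t v))\<^sup>2
          \<le> \<Psi>t t v + \<Psi>v t v \<bullet> drift u v + 1/2 * sq_norm_wrt S u"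
        unfolding ham using m(2)[of "u - w t v"] by simp
    qed
    show "0 \<le> G s v"
      using hamiltonian_nonneg[OF s, of v "w s v"] unfolding ham by (simp add: sq_norm_wrt_def)
  qed
  have cl: "closure {0..<\<tau>} = {0..\<tau>}" using \<open>\<tau> > 0\<close> by simp
  have "continuous_on {0..\<tau>} (\<lambda>s. case (s, v) of (t, v) \<Rightarrow> G t v)"
    by (rule continuous_on_compose2[OF contG]) (auto intro!: continuous_intros)
  then have "continuous_on (closure {0..<\<tau>}) (\<lambda>s. G s v)" unfolding cl by simp
  then have "G t v = 0"
    by (rule continuous_constant_on_closure[where f = "\<lambda>s. G s v"]) (use cl t in \<open>simp_all add: zero\<close>)
  then show ?thesis by (simp add: G_def)
qed

theorem theorem3:
  fixes \<rho>0 :: "complex^'d^'d" and X0 :: "complex^'d^'d^'n"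
    and \<alpha> :: "real^'n^'n" and \<beta> :: "complex^'n^'n^'n"
    and E :: "real^'n" and K :: "real^'r^'n"
    and M :: "real^'n^('k::finite \<times> 2)" and N :: "real^('k \<times> 2)"
    and F :: "real^'n^'f" and S :: "real^'r^'r" and \<tau> :: real
    and \<mu>0 \<sigma> b :: "real^'n" and P Sg A0 :: "real^'n^'n" and AA :: "real^'r^'n^'n"
    and R c :: "real^('n option)^'n" and d :: real
    and \<Psi> \<Psi>t :: "real \<Rightarrow> real^('n option)^'n \<Rightarrow> real"
    and \<Psi>v :: "real \<Rightarrow> real^('n option)^'n \<Rightarrow> real^('n option)^'n"
  assumes "density_operator \<rho>0"
    and "algebraic_vars \<alpha> \<beta> X0"
    and "rank F = CARD('f)"
    and "\<tau> > 0"
    and "pos_def S"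
    and "\<mu>0 = mean_vec \<rho>0 X0"
    and "P = second_moments \<rho>0 X0"
    and "Sg = transpose F ** F"
    and "\<sigma> = star_prod Sg (Re_array \<beta>)"
    and "R = hcat \<sigma> (- 2 *\<^sub>R Sg)"
    and "d = 2 * (Sg \<bullet> P) - \<sigma> \<bullet> \<mu>0"
    and "b = drift_b \<beta> \<alpha> M"
    and "c = outer_one b \<mu>0"
    and "A0 = drift_A \<beta> E M N"
    and "AA = control_array \<beta> K"
    and "\<And>t v. t \<in> {0..\<tau>} \<Longrightarrow> ereal (\<Psi> t v) = bellman A0 AA c R d S \<tau> t v"
    and "C1_with_partials \<tau> \<Psi> \<Psi>t \<Psi>v"
  shows "(\<forall>t\<in>{0..\<tau>}. \<forall>v.
            attains_min (hjb_objective A0 AA c S (\<Psi>v t v) v) (- \<Psi>t t v)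
            \<and> \<Psi>t t v + \<Psi>v t v \<bullet> (A0 ** v + c)
                - 1/2 * sq_norm_wrt (matrix_inv S) (star_prod (\<Psi>v t v ** transpose v) AA) = 0)
       \<and> (\<forall>v. \<Psi> \<tau> v = R \<bullet> v + d)
       \<and> (\<forall>t\<in>{0..\<tau>}. \<forall>v.
            (\<exists>!u. is_arg_min (hjb_objective A0 AA c S (\<Psi>v t v) v) (\<lambda>_. True) u)
            \<and> optimal_control A0 AA c S \<Psi>v t v
                = - (matrix_inv S *v star_prod (\<Psi>v t v ** transpose v) AA))"
proof (intro conjI ballI allI)
  have optimal: "is_arg_min (hjb_objective A0 AA c S (\<Psi>v t v) v) (\<lambda>_. True) u
      \<longleftrightarrow> u = - (matrix_inv S *v star_prod (\<Psi>v t v ** transpose v) AA)" for t v u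
    by (rule is_arg_min_hjb_objective_iff[OF \<open>pos_def S\<close>])
  fix v
  show "\<Psi> \<tau> v = R \<bullet> v + d"
    using assms(4,16) by (intro bellman_terminal[of _ A0 AA c R d S \<tau>]) simp
  fix t assume t: "t \<in> {0..\<tau>}"
  show pde: "\<Psi>t t v + \<Psi>v t v \<bullet> (A0 ** v + c)
      - 1/2 * sq_norm_wrt (matrix_inv S) (star_prod (\<Psi>v t v ** transpose v) AA) = 0"
    by (rule smooth_bellman_hjb[OF assms(4,5,16,17) t])
  \<comment> \<open>At the minimiser the square vanishes, and the PDE identifies the remaining
    control-free part with \<open>- \<Psi>t t v\<close>.\<close>
  show "attains_min (hjb_objective A0 AA c S (\<Psi>v t v) v) (- \<Psi>t t v)"
    using pde unfolding attains_min_def optimal hjb_objective_complete_square[OF \<open>pos_def S\<close>]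
    by (simp add: sq_norm_wrt_def)
  show "\<exists>!u. is_arg_min (hjb_objective A0 AA c S (\<Psi>v t v) v) (\<lambda>_. True) u"
    unfolding optimal by simp
  show "optimal_control A0 AA c S \<Psi>v t v
      = - (matrix_inv S *v star_prod (\<Psi>v t v ** transpose v) AA)"
    unfolding optimal_control_def optimal by simp
qed

end
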